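(* Let $H$ be a mixed Hodge structure. Then $\alpha(H)=0$ if and only if $H$ is $\mathbf R$-split.
   Context: A mixed Hodge structure $H$ is a finite-dimensional $\mathbf{Q}$-vector space $H_{\mathbf Q}$ with a finite increasing filtration $W_\bullet$ (weight filtration; also written $W_\bullet$ on $H_{\mathbf C}=H_{\mathbf Q}\otimes\mathbf{C}$) and a finite decreasing filtration $F^\bullet$ of $H_{\mathbf C}$ (Hodge filtration) such that $F^\bullet$ induces on each $Gr^W_nH_{\mathbf C}$ a pure Hodge structure of weight $n$. $\overline F^\bullet$ denotes the filtration complex conjugate to $F^\bullet$ with respect to the real structure $H_{\mathbf R}=H_{\mathbf Q}\otimes\mathbf{R}$. Put $$h^{p,q}_H=\dim_{\mathbf C}Gr^q_{\overline F}Gr^p_FGr^W_{p+q}H_{\mathbf C},\qquad t^{p,q}_H=\dim_{\mathbf C}Gr^q_{\overline F}Gr^p_FH_{\mathbf C},$$ $$\alpha(H)=\frac12\sum_{p,q\in\mathbf Z}(p+q)^2\,(h^{p,q}_H-t^{p,q}_H).$$ Deligne's canonical bigrading $H_{\mathbf C}=\bigoplus_{p,q}I^{p,q}$ is given by $$I^{p,q}=(F^p\cap W_{p+q})\cap\Big(\overline F^q\cap W_{p+q}+\sum_{i\ge1}\overline F^{q-i}\cap W_{p+q-i-1}\Big);$$ it satisfies $W_m=\bigoplus_{p+q\le m}I^{p,q}$, $F^p=\bigoplus_{i\ge p}\bigoplus_qI^{i,q}$ and $I^{p,q}\equiv\overline{I^{q,p}}$ mod $W_{p+q-2}$. $H$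 is called $\mathbf R$-split if $I^{p,q}=\overline{I^{q,p}}$ for all $p,q$. *)

theory Defs
  imports
    "Jordan_Normal_Form.VS_Connect"
    "HOL-Algebra.AbelCoset"
    "HOL-Library.Groups_Big_Fun"
begin

abbreviation rat_field :: "rat ring" where
  "rat_field \<equiv> class_ring"

abbreviation complex_field :: "complex ring" where
  "complex_field \<equiv> class_ring"

section \<open>Filtrations and their graded pieces\<close>

definition increasing_filtration ::
  "('k, 'r) ring_scheme \<Rightarrow> ('k, 'v, 'm) module_scheme \<Rightarrow> (int \<Rightarrow> 'v set) \<Rightarrow> bool" where
  "increasing_filtration K V W \<longleftrightarrow>
     (\<forall>n. subspace K (W n) V) \<and> (\<forall>m n. m \<le> n \<longrightarrow> W m \<subseteq> W n) \<and>
     (\<exists>n. W n = {\<zero>\<^bsub>V\<^esub>}) \<and> (\<exists>n. W n = carrier V)"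

definition decreasing_filtration ::
  "('k, 'r) ring_scheme \<Rightarrow> ('k, 'v, 'm) module_scheme \<Rightarrow> (int \<Rightarrow> 'v set) \<Rightarrow> bool" where
  "decreasing_filtration K V F \<longleftrightarrow>
     (\<forall>p. subspace K (F p) V) \<and> (\<forall>p q. p \<le> q \<longrightarrow> F q \<subseteq> F p) \<and>
     (\<exists>p. F p = carrier V) \<and> (\<exists>p. F p = {\<zero>\<^bsub>V\<^esub>})"

text \<open>
  The quotient \<open>A / B\<close> for subspaces \<open>B \<subseteq> A\<close> of \<open>V\<close>; its vectors are the cosets \<open>B + x\<close> with
  \<open>x \<in> A\<close>. The summand \<open>B\<close> in the scalar multiplication only matters for the scalar zero, where
  the elementwise multiple of a coset is \<open>{0}\<close> instead of \<open>B\<close>. A module record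
  extends a ring record; the ring multiplication and its unit have no meaning here.
\<close>

definition subquotient :: "('k, 'v, 'm) module_scheme \<Rightarrow> 'v set \<Rightarrow> 'v set \<Rightarrow> ('k, 'v set) module" where
  "subquotient V A B =
     \<lparr>carrier = (\<lambda>x. B +>\<^bsub>V\<^esub> x) ` A, mult = undefined, one = undefined,
      zero = B, add = (\<lambda>X Y. X <+>\<^bsub>V\<^esub> Y), smult = (\<lambda>c X. B <+>\<^bsub>V\<^esub> ((\<lambda>x. c \<odot>\<^bsub>V\<^esub> x) ` X))\<rparr>"

text \<open>The filtration that a filtration \<open>E\<close> of \<open>V\<close> induces on \<open>A / B\<close>.\<close>

definition induced_filtration ::
  "('k, 'v, 'm) module_scheme \<Rightarrow> 'v set \<Rightarrow> 'v set \<Rightarrow> (int \<Rightarrow> 'v set) \<Rightarrow> int \<Rightarrow> 'v set set" where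
  "induced_filtration V A B E q = (\<lambda>x. B +>\<^bsub>V\<^esub> x) ` (E q \<inter> A)"

text \<open>\<open>gr V F p\<close> is \<open>Gr\<^sup>p\<^sub>F V\<close> for decreasing \<open>F\<close>, and \<open>gr_filtration V F p G\<close> the filtration
  that \<open>G\<close> induces on it.\<close>

definition gr :: "('k, 'v, 'm) module_scheme \<Rightarrow> (int \<Rightarrow> 'v set) \<Rightarrow> int \<Rightarrow> ('k, 'v set) module" where
  "gr V F p = subquotient V (F p) (F (p + 1))"

definition gr_filtration ::
  "('k, 'v, 'm) module_scheme \<Rightarrow> (int \<Rightarrow> 'v set) \<Rightarrow> int \<Rightarrow> (int \<Rightarrow> 'v set) \<Rightarrow> int \<Rightarrow> 'v set set" where
  "gr_filtration V F p G = induced_filtration V (F p) (F (p + 1)) G"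

text \<open>The complex dimension of \<open>Gr\<^sup>q\<^sub>G Gr\<^sup>p\<^sub>F V\<close>.\<close>

definition gr_gr_dim ::
  "(complex, 'v, 'm) module_scheme \<Rightarrow> (int \<Rightarrow> 'v set) \<Rightarrow> (int \<Rightarrow> 'v set) \<Rightarrow> int \<Rightarrow> int \<Rightarrow> nat" where
  "gr_gr_dim V F G p q = vectorspace.dim complex_field (gr (gr V F p) (gr_filtration V F p G) q)"

section \<open>Complexification\<close>

text \<open>
  \<open>HC\<close> together with \<open>\<iota>\<close>, thought of as \<open>v \<mapsto> v \<otimes> 1\<close>, is a model of the tensor product of
  \<open>HQ\<close> with the complex numbers over the rationals. This is determined up to unique isomorphism.
\<close>

locale complexification =
  HQ: vectorspace rat_field HQ + HC: vectorspace complex_field HC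
  for HQ :: "(rat, 'q) module" and HC :: "(complex, 'c) module" +
  fixes \<iota> :: "'q \<Rightarrow> 'c"
  assumes \<iota>_closed: "\<And>v. v \<in> carrier HQ \<Longrightarrow> \<iota> v \<in> carrier HC"
    and \<iota>_add: "\<And>v w. v \<in> carrier HQ \<Longrightarrow> w \<in> carrier HQ \<Longrightarrow> \<iota> (v \<oplus>\<^bsub>HQ\<^esub> w) = \<iota> v \<oplus>\<^bsub>HC\<^esub> \<iota> w"
    and \<iota>_smult: "\<And>r v. v \<in> carrier HQ \<Longrightarrow> \<iota> (r \<odot>\<^bsub>HQ\<^esub> v) = of_rat r \<odot>\<^bsub>HC\<^esub> \<iota> v"
    and \<iota>_basis: "\<And>B. HQ.basis B \<Longrightarrow> inj_on \<iota> B \<and> HC.basis (\<iota> ` B)"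
begin

text \<open>The map \<open>v \<otimes> c \<mapsto> v \<otimes> cnj c\<close>; extensionality outside the carrier makes it unique as a
  function.\<close>

definition conjugation :: "'c \<Rightarrow> 'c" where
  "conjugation = (THE \<sigma>. \<sigma> \<in> carrier HC \<rightarrow>\<^sub>E carrier HC \<and>
     (\<forall>x\<in>carrier HC. \<forall>y\<in>carrier HC. \<sigma> (x \<oplus>\<^bsub>HC\<^esub> y) = \<sigma> x \<oplus>\<^bsub>HC\<^esub> \<sigma> y) \<and>
     (\<forall>c. \<forall>v\<in>carrier HQ. \<sigma> (c \<odot>\<^bsub>HC\<^esub> \<iota> v) = cnj c \<odot>\<^bsub>HC\<^esub> \<iota> v))"

end

section \<open>Mixed Hodge structures\<close>

text \<open>
  The filtration \<open>F\<close> makes the complex vector space \<open>V\<close>, with complex conjugation \<open>\<sigma>\<close>, a pure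
  Hodge structure of weight \<open>n\<close>: the space is the direct sum of \<open>F\<^sup>p\<close> and of the conjugate
  of \<open>F\<^sup>n\<^sup>+\<^sup>1\<^sup>-\<^sup>p\<close> for every \<open>p\<close>.
\<close>

definition pure_hodge_structure ::
  "int \<Rightarrow> (complex, 'v, 'm) module_scheme \<Rightarrow> ('v \<Rightarrow> 'v) \<Rightarrow> (int \<Rightarrow> 'v set) \<Rightarrow> bool" where
  "pure_hodge_structure n V \<sigma> F \<longleftrightarrow>
     decreasing_filtration complex_field V F \<and>
     (\<forall>p. F p <+>\<^bsub>V\<^esub> (\<sigma> ` F (n + 1 - p)) = carrier V \<and> F p \<inter> \<sigma> ` F (n + 1 - p) = {\<zero>\<^bsub>V\<^esub>})"

locale pre_mixed_hodge_structure = complexification HQ HC \<iota>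
  for HQ :: "(rat, 'q) module" and HC :: "(complex, 'c) module" and \<iota> :: "'q \<Rightarrow> 'c" +
  fixes W :: "int \<Rightarrow> 'q set" and F :: "int \<Rightarrow> 'c set"
  assumes HQ_fin_dim: "HQ.fin_dim"
    and W_filtration: "increasing_filtration rat_field HQ W"
    and F_filtration: "decreasing_filtration complex_field HC F"
begin

definition WC :: "int \<Rightarrow> 'c set" where
  "WC n = HC.span (\<iota> ` W n)"

definition grW :: "int \<Rightarrow> (complex, 'c set) module" where
  "grW n = subquotient HC (WC n) (WC (n - 1))"

definition grW_filtration :: "int \<Rightarrow> (int \<Rightarrow> 'c set) \<Rightarrow> int \<Rightarrow> 'c set set" where
  "grW_filtration n E = induced_filtration HC (WC n) (WC (n - 1)) E"

definition Fbar :: "int \<Rightarrow> 'c set" where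
  "Fbar p = conjugation ` F p"

end

text \<open>Since \<open>WC (n - 1)\<close> is stable under conjugation, the conjugation induced on \<open>grW n\<close> maps a coset
  to its image under conjugation.\<close>

locale mixed_hodge_structure = pre_mixed_hodge_structure HQ HC \<iota> W F
  for HQ :: "(rat, 'q) module" and HC :: "(complex, 'c) module" and \<iota> :: "'q \<Rightarrow> 'c"
    and W :: "int \<Rightarrow> 'q set" and F :: "int \<Rightarrow> 'c set" +
  assumes grW_pure: "\<And>n. pure_hodge_structure n (grW n) (\<lambda>X. conjugation ` X) (grW_filtration n F)"
begin

definition hodge_h :: "int \<Rightarrow> int \<Rightarrow> nat" where
  "hodge_h p q =
     gr_gr_dim (grW (p + q)) (grW_filtration (p + q) F) (grW_filtration (p + q) Fbar) p q"

definition hodge_t :: "int \<Rightarrow> int \<Rightarrow> nat" where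
  "hodge_t p q = gr_gr_dim HC F Fbar p q"

text \<open>Only finitely many terms are nonzero, so \<open>Sum_any\<close> is the sum over all pairs.\<close>

definition alpha :: real where
  "alpha = 1 / 2 * Sum_any (\<lambda>(p, q).
     (real_of_int (p + q))\<^sup>2 * (real (hodge_h p q) - real (hodge_t p q)))"

text \<open>Deligne's \<open>I\<^sup>p\<^sup>,\<^sup>q\<close>; the sum of the infinite family of subspaces is the span of their
  union.\<close>

definition deligne_I :: "int \<Rightarrow> int \<Rightarrow> 'c set" where
  "deligne_I p q =
     (F p \<inter> WC (p + q)) \<inter>
     ((Fbar q \<inter> WC (p + q)) <+>\<^bsub>HC\<^esub>
        HC.span (\<Union>i\<in>{1..}. Fbar (q - i) \<inter> WC (p + q - i - 1)))"

definition R_split :: bool where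
  "R_split \<longleftrightarrow> (\<forall>p q. deligne_I p q = conjugation ` deligne_I q p)"

end

end

theory Submission
  imports Defs "Jordan_Normal_Form.DL_Rank"
begin

text \<open>
  The Hodge numbers \<open>h\<close> and \<open>t\<close> are second differences, in \<open>p\<close> and \<open>q\<close>, of the dimensions of
  \<open>F\<^sup>p \<inter> Fbar\<^sup>q\<close> taken in the graded pieces \<open>Gr\<^sub>n\<close> of \<open>W\<close>, respectively in the whole space.
  Summing by parts twice against \<open>(p + q)\<^sup>2\<close> gives \<open>\<alpha> = \<Sum> defect n p q\<close>, where
  \<open>defect n p q \<ge> 0\<close> is the codimension of the image of \<open>F\<^sup>p \<inter> Fbar\<^sup>q \<inter> W\<^sub>n\<close> in
  \<open>F\<^sup>p Gr\<^sub>n \<inter> Fbar\<^sup>q Gr\<^sub>n\<close>. So \<open>\<alpha> = 0\<close> iff all these images are as large as possible, and by purity it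
  suffices to require this for \<open>p + q = n\<close>.

  On the other hand \<open>I\<^sup>p\<^sup>,\<^sup>q\<close> contains \<open>F\<^sup>p \<inter> Fbar\<^sup>q \<inter> W\<^sub>p\<^sub>+\<^sub>q\<close> and maps isomorphically onto the classes of type
  \<open>(p, q)\<close> in \<open>Gr\<^sub>p\<^sub>+\<^sub>q\<close>. If these classes all lift to \<open>F\<^sup>p \<inter> Fbar\<^sup>q \<inter> W\<^sub>p\<^sub>+\<^sub>q\<close>, the two spaces agree and
  conjugation exchanges \<open>p\<close> and \<open>q\<close>; conversely, an \<open>\<real>\<close>-split \<open>I\<^sup>p\<^sup>,\<^sup>q\<close> lies in \<open>Fbar\<^sup>q\<close>, so it provides
  the lifts.
\<close>

section \<open>Dimensions of subspaces and of subquotients\<close>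

context vectorspace
begin

lemma subspaceI:
  assumes "S \<subseteq> carrier V" "\<zero>\<^bsub>V\<^esub> \<in> S"
    and "\<And>v w. v \<in> S \<Longrightarrow> w \<in> S \<Longrightarrow> v \<oplus>\<^bsub>V\<^esub> w \<in> S"
    and "\<And>c v. c \<in> carrier K \<Longrightarrow> v \<in> S \<Longrightarrow> c \<odot>\<^bsub>V\<^esub> v \<in> S"
  shows "subspace K S V"
  unfolding subspace_def submodule_def using assms vectorspace_axioms module_axioms by auto

lemma subspaceD:
  assumes "subspace K S V"
  shows "S \<subseteq> carrier V" "\<zero>\<^bsub>V\<^esub> \<in> S"
    and "\<And>v w. v \<in> S \<Longrightarrow> w \<in> S \<Longrightarrow> v \<oplus>\<^bsub>V\<^esub> w \<in> S"
    and "\<And>c v. c \<in> carrier K \<Longrightarrow> v \<in> S \<Longrightarrow> c \<odot>\<^bsub>V\<^esub> v \<in> S"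
    and "\<And>v. v \<in> S \<Longrightarrow> \<ominus>\<^bsub>V\<^esub> v \<in> S"
    and "\<And>v w. v \<in> S \<Longrightarrow> w \<in> S \<Longrightarrow> v \<ominus>\<^bsub>V\<^esub> w \<in> S"
    and "\<And>v. v \<in> S \<Longrightarrow> v \<in> carrier V"
proof -
  interpret submodule K S V using assms by (rule is_module)
  show 1: "S \<subseteq> carrier V" "\<zero>\<^bsub>V\<^esub> \<in> S"
    "\<And>v w. v \<in> S \<Longrightarrow> w \<in> S \<Longrightarrow> v \<oplus>\<^bsub>V\<^esub> w \<in> S"
    "\<And>c v. c \<in> carrier K \<Longrightarrow> v \<in> S \<Longrightarrow> c \<odot>\<^bsub>V\<^esub> v \<in> S"
    using subset by auto
  show 2: "v \<in> carrier V" if "v \<in> S" for v using that 1 by auto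
  show 3: "\<ominus>\<^bsub>V\<^esub> v \<in> S" if "v \<in> S" for v
    using 1(4)[OF _ that, of "\<ominus>\<^bsub>K\<^esub> \<one>\<^bsub>K\<^esub>"] smult_minus_1[OF 2[OF that]] by simp
  show "v \<ominus>\<^bsub>V\<^esub> w \<in> S" if "v \<in> S" "w \<in> S" for v w
    using that 1 3 by (simp add: M.minus_eq)
qed

lemma subspace_Int:
  assumes "subspace K S V" "subspace K T V"
  shows "subspace K (S \<inter> T) V"
proof (rule subspaceI)
  show "S \<inter> T \<subseteq> carrier V" using subspaceD(1)[OF assms(1)] by blast
qed (simp_all add: subspaceD(2-4)[OF assms(1)] subspaceD(2-4)[OF assms(2)])

lemma subspace_zero: "subspace K {\<zero>\<^bsub>V\<^esub>} V"
  by (rule subspaceI) simp_all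

lemma subspace_set_add:
  assumes S: "subspace K S V" and T: "subspace K T V"
  shows "subspace K (S <+>\<^bsub>V\<^esub> T) V"
proof -
  have "S <+>\<^bsub>V\<^esub> T = subspace_sum S T"
    unfolding set_add_def' submodule_sum_def by auto
  then show ?thesis using sum_is_subspace[OF S T] by simp
qed

lemma subspace_vs_iff:
  assumes "subspace K S V" "T \<subseteq> S"
  shows "subspace K T (vs S) \<longleftrightarrow> subspace K T V"
proof -
  interpret S: vectorspace K "vs S" using assms(1) by (rule subspace_is_vs)
  show ?thesis
  proof
    assume T: "subspace K T (vs S)"
    show "subspace K T V"
      using S.subspaceD(2-4)[OF T] assms(2) subspaceD(1)[OF assms(1)]
      by (intro subspaceI) auto
  next
    assume T: "subspace K T V"
    show "subspace K T (vs S)"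
      using subspaceD(2-4)[OF T] assms(2) by (intro S.subspaceI) auto
  qed
qed

text \<open>Sets that are independent in \<open>S\<close> are independent in \<open>V\<close>, so
  their size is bounded by \<open>dim\<close>. Hence a maximal one exists, and it generates
  \<open>S\<close>.\<close>

lemma fin_dim_subspace:
  assumes fd: fin_dim and S: "subspace K S V"
  shows "vectorspace.fin_dim K (vs S)"
proof -
  interpret S: vectorspace K "vs S" using S by (rule subspace_is_vs)
  note SV = subspaceD(1)[OF S]
  have li: "S.lin_indpt A \<longleftrightarrow> lin_indpt A" if "A \<subseteq> S" for A
    using span_li_not_depend(2)[OF that is_module[OF S]] by simp
  have "\<exists>A. finite A \<and> maximal A (\<lambda>A. A \<subseteq> carrier (vs S) \<and> S.lin_indpt A)"
  proof (rule maximal_exists)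
    show "finite A \<and> card A \<le> dim" if "A \<subseteq> carrier (vs S) \<and> S.lin_indpt A" for A
      using that li[of A] li_le_dim[OF fd, of A] SV by auto
    show "{} \<subseteq> carrier (vs S) \<and> S.lin_indpt {}"
      by (auto simp: S.lin_dep_def)
  qed
  then obtain A where A: "finite A" "maximal A (\<lambda>A. A \<subseteq> carrier (vs S) \<and> S.lin_indpt A)" by blast
  from S.max_li_is_gen[OF A(2)] A show ?thesis
    unfolding S.fin_dim_def maximal_def by blast
qed

definition sdim :: "'c set \<Rightarrow> nat" where
  "sdim S = vectorspace.dim K (vs S)"

lemma sdim_zero: "sdim {\<zero>\<^bsub>V\<^esub>} = 0"
proof -
  interpret Z: vectorspace K "vs {\<zero>\<^bsub>V\<^esub>}" using subspace_zero by (rule subspace_is_vs)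
  show ?thesis unfolding sdim_def
    using Z.span_is_subset2[of "{\<zero>\<^bsub>V\<^esub>}"] Z.in_own_span[of "{\<zero>\<^bsub>V\<^esub>}"]
    by (intro Z.dim0I) auto
qed

lemma sdim_carrier: "sdim (carrier V) = dim"
  unfolding sdim_def by simp

lemma sdim_mono:
  assumes fd: fin_dim and "subspace K S V" "subspace K T V" "S \<subseteq> T"
  shows "sdim S \<le> sdim T"
proof -
  interpret T: vectorspace K "vs T" using assms(3) by (rule subspace_is_vs)
  have sub: "subspace K S (vs T)" using subspace_vs_iff[OF assms(3,4)] assms(2) by simp
  have fdT: "T.fin_dim" by (rule fin_dim_subspace[OF fd assms(3)])
  have "vectorspace.fin_dim K (T.vs S)" by (rule T.fin_dim_subspace[OF fdT sub])
  then show ?thesis using T.subspace_dim[OF sub fdT] by (simp add: sdim_def)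
qed

text \<open>A basis of \<open>S\<close> is independent in \<open>T\<close> and has as many elements
  as a basis of \<open>T\<close>, so it is one. Spans do not depend on which of the two spaces they
  are formed in.\<close>

lemma sdim_eq_imp_eq:
  assumes fd: fin_dim and S: "subspace K S V" and T: "subspace K T V" and "S \<subseteq> T" "sdim S = sdim T"
  shows "S = T"
proof -
  interpret T: vectorspace K "vs T" using T by (rule subspace_is_vs)
  interpret S: vectorspace K "vs S" using S by (rule subspace_is_vs)
  have fdS: "S.fin_dim" and fdT: "T.fin_dim" using fin_dim_subspace[OF fd] S T by auto
  obtain A where A: "finite A" "S.basis A" using S.finite_basis_exists[OF fdS] by blast
  then have AS: "A \<subseteq> S" "S.lin_indpt A" "S.span A = S" by (auto simp: S.basis_def)
  have "T.lin_indpt A"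
    using AS span_li_not_depend(2)[OF AS(1) is_module[OF S]]
      span_li_not_depend(2)[OF _ is_module[OF T], of A] assms(4) by auto
  moreover have "card A \<ge> T.dim" using S.dim_basis[OF A] assms(5) by (simp add: sdim_def)
  ultimately have "T.basis A" using T.dim_li_is_basis[OF fdT A(1)] AS(1) assms(4) by auto
  then have "T.span A = T" by (auto simp: T.basis_def)
  moreover have "T.span A = span A" "S.span A = span A"
    using span_li_not_depend(1)[OF _ is_module[OF T], of A]
      span_li_not_depend(1)[OF _ is_module[OF S], of A] AS(1) assms(4) by auto
  ultimately show ?thesis using AS(3) by simp
qed

end

text \<open>Rank-nullity for a map that is required to be linear on \<open>S\<close> only. The coset
  map into a subquotient \<open>A / B\<close> needs this form: its values lie in the carrier of the
  quotient only for arguments from \<open>A\<close>.\<close>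

lemma linear_map_sdim:
  assumes V: "vectorspace K V" and Q: "vectorspace K Q" and fd: "vectorspace.fin_dim K V"
    and S: "subspace K S V"
    and closed: "\<And>v. v \<in> S \<Longrightarrow> f v \<in> carrier Q"
    and add: "\<And>v w. v \<in> S \<Longrightarrow> w \<in> S \<Longrightarrow> f (v \<oplus>\<^bsub>V\<^esub> w) = f v \<oplus>\<^bsub>Q\<^esub> f w"
    and smult: "\<And>c v. c \<in> carrier K \<Longrightarrow> v \<in> S \<Longrightarrow> f (c \<odot>\<^bsub>V\<^esub> v) = c \<odot>\<^bsub>Q\<^esub> f v"
  shows "vectorspace.sdim K Q (f ` S) + vectorspace.sdim K V {v \<in> S. f v = \<zero>\<^bsub>Q\<^esub>} = vectorspace.sdim K V S"
    and "f ` S = carrier Q \<Longrightarrow> vectorspace.fin_dim K Q"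
proof -
  interpret V: vectorspace K V by fact
  interpret Q: vectorspace K Q by fact
  interpret S: vectorspace K "V.vs S" using S by (rule V.subspace_is_vs)
  have "f \<in> LinearCombinations.module_hom K (V.vs S) Q"
    unfolding LinearCombinations.module_hom_def using closed add smult by simp
  then interpret lm: linear_map K "V.vs S" Q f
    by (intro linear_map.intro mod_hom.intro mod_hom_axioms.intro
        S.vectorspace_axioms Q.vectorspace_axioms S.module_axioms Q.module_axioms)
  have "S.fin_dim" using V.fin_dim_subspace[OF fd S] .
  show "Q.fin_dim" if "f ` S = carrier Q"
    using lm.rank_nullity_main(2)[OF \<open>S.fin_dim\<close>] that by simp
  from lm.rank_nullity[OF \<open>S.fin_dim\<close>] show "Q.sdim (f ` S) + V.sdim {v \<in> S. f v = \<zero>\<^bsub>Q\<^esub>} = V.sdim S"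
    by (simp add: lm.im_def lm.ker_def V.sdim_def Q.sdim_def)
qed

lemma (in abelian_group) diff_zero: "x \<in> carrier G \<Longrightarrow> x \<ominus> \<zero> = x"
  using minus_equality[of \<zero> \<zero>] by (simp add: minus_eq)

section \<open>Cosets of a subspace\<close>

context vectorspace
begin

lemma abelian_subgroup_subspace:
  assumes "subspace K B V"
  shows "abelian_subgroup B V"
proof -
  note B = subspaceD[OF assms]
  have "subgroup B (add_monoid V)"
    by (rule subgroup.intro) (auto simp: B(1-3) simp flip: a_inv_def intro: B(5))
  then show ?thesis
    by (intro abelian_subgroupI3 additive_subgroupI M.abelian_group_axioms)
qed

lemma coset_eq_iff:
  assumes B: "subspace K B V" and x: "x \<in> carrier V" and y: "y \<in> carrier V"
  shows "B +>\<^bsub>V\<^esub> x = B +>\<^bsub>V\<^esub> y \<longleftrightarrow> x \<ominus>\<^bsub>V\<^esub> y \<in> B"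
proof -
  interpret B: abelian_subgroup B V using B by (rule abelian_subgroup_subspace)
  have "B +>\<^bsub>V\<^esub> x = B +>\<^bsub>V\<^esub> y \<longleftrightarrow> x \<in> B +>\<^bsub>V\<^esub> y"
    using B.a_repr_independence'[OF _ y] B.a_repr_independenceD[OF x] by metis
  then show ?thesis using B.a_rcos_module[OF y x] by (simp add: M.minus_eq)
qed

lemma coset_eq_self_iff:
  assumes B: "subspace K B V" and x: "x \<in> carrier V"
  shows "B +>\<^bsub>V\<^esub> x = B \<longleftrightarrow> x \<in> B"
  using coset_eq_iff[OF B x, of "\<zero>\<^bsub>V\<^esub>"] M.a_coset_add_zero[OF subspaceD(1)[OF B]] x
  by (simp add: M.diff_zero)

lemma coset_add:
  assumes B: "subspace K B V" and "x \<in> carrier V" "y \<in> carrier V"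
  shows "(B +>\<^bsub>V\<^esub> x) <+>\<^bsub>V\<^esub> (B +>\<^bsub>V\<^esub> y) = B +>\<^bsub>V\<^esub> (x \<oplus>\<^bsub>V\<^esub> y)"
proof -
  interpret B: abelian_subgroup B V using B by (rule abelian_subgroup_subspace)
  show ?thesis using assms by (simp add: B.a_rcos_sum)
qed

text \<open>The left summand \<open>B\<close> already supplies every element of \<open>B\<close>
  needed, with zero as the element of \<open>B\<close> inside the coset on the right. So no division
  by \<open>c\<close> occurs, and the case of the scalar zero is covered.\<close>

lemma coset_smult:
  assumes B: "subspace K B V" and x: "x \<in> carrier V" and c: "c \<in> carrier K"
  shows "B <+>\<^bsub>V\<^esub> ((\<lambda>v. c \<odot>\<^bsub>V\<^esub> v) ` (B +>\<^bsub>V\<^esub> x)) = B +>\<^bsub>V\<^esub> (c \<odot>\<^bsub>V\<^esub> x)"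
proof
  note BD = subspaceD[OF B]
  have eq: "b \<oplus>\<^bsub>V\<^esub> c \<odot>\<^bsub>V\<^esub> (b' \<oplus>\<^bsub>V\<^esub> x) = (b \<oplus>\<^bsub>V\<^esub> c \<odot>\<^bsub>V\<^esub> b') \<oplus>\<^bsub>V\<^esub> c \<odot>\<^bsub>V\<^esub> x"
    if "b \<in> B" "b' \<in> B" for b b'
    using that x c BD(7) by (simp add: smult_r_distr M.a_assoc)
  show "B <+>\<^bsub>V\<^esub> ((\<lambda>v. c \<odot>\<^bsub>V\<^esub> v) ` (B +>\<^bsub>V\<^esub> x)) \<subseteq> B +>\<^bsub>V\<^esub> (c \<odot>\<^bsub>V\<^esub> x)"
    unfolding a_r_coset_def' set_add_def' using BD(3) BD(4)[OF c] by (force simp: eq)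
  show "B +>\<^bsub>V\<^esub> (c \<odot>\<^bsub>V\<^esub> x) \<subseteq> B <+>\<^bsub>V\<^esub> ((\<lambda>v. c \<odot>\<^bsub>V\<^esub> v) ` (B +>\<^bsub>V\<^esub> x))"
  proof
    fix v assume "v \<in> B +>\<^bsub>V\<^esub> (c \<odot>\<^bsub>V\<^esub> x)"
    then obtain b where "b \<in> B" "v = b \<oplus>\<^bsub>V\<^esub> c \<odot>\<^bsub>V\<^esub> (\<zero>\<^bsub>V\<^esub> \<oplus>\<^bsub>V\<^esub> x)"
      unfolding a_r_coset_def' using x by auto
    then show "v \<in> B <+>\<^bsub>V\<^esub> ((\<lambda>v. c \<odot>\<^bsub>V\<^esub> v) ` (B +>\<^bsub>V\<^esub> x))"
      unfolding a_r_coset_def' set_add_def' using BD(2) by blast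
  qed
qed

end

section \<open>Subquotients as vector spaces\<close>

lemma subquotient_simps [simp]:
  "carrier (subquotient V A B) = (\<lambda>x. B +>\<^bsub>V\<^esub> x) ` A"
  "\<zero>\<^bsub>subquotient V A B\<^esub> = B"
  "X \<oplus>\<^bsub>subquotient V A B\<^esub> Y = X <+>\<^bsub>V\<^esub> Y"
  "c \<odot>\<^bsub>subquotient V A B\<^esub> X = B <+>\<^bsub>V\<^esub> ((\<lambda>x. c \<odot>\<^bsub>V\<^esub> x) ` X)"
  by (simp_all add: subquotient_def)

locale subquotient_space = vectorspace K V for K and V (structure) +
  fixes A B
  assumes A: "subspace K A V" and B: "subspace K B V" and BA: "B \<subseteq> A"
begin

abbreviation Q where "Q \<equiv> subquotient V A B"

lemma A_carrier: "x \<in> A \<Longrightarrow> x \<in> carrier V"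
  using subspaceD(1)[OF A] by blast

lemma coset_zero: "B +> \<zero>\<^bsub>V\<^esub> = B"
  using coset_eq_self_iff[OF B] subspaceD(2)[OF B] by simp

lemma subquotient_vectorspace: "vectorspace K Q"
proof (rule vs_criteria)
  note [simp] = coset_add[OF B] coset_smult[OF B] A_carrier
  note AD = subspaceD[OF A]
  show "field K" by (rule field_axioms)
  show "\<zero>\<^bsub>Q\<^esub> \<in> carrier Q"
    using coset_zero AD(2) by (auto intro!: image_eqI[of _ _ "\<zero>\<^bsub>V\<^esub>"])
  show "\<forall>v w. v \<in> carrier Q \<and> w \<in> carrier Q \<longrightarrow> v \<oplus>\<^bsub>Q\<^esub> w \<in> carrier Q"
    using AD(3) by auto
  show "\<forall>v\<in>carrier Q. \<exists>w\<in>carrier Q. v \<oplus>\<^bsub>Q\<^esub> w = \<zero>\<^bsub>Q\<^esub>"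
  proof
    fix v assume "v \<in> carrier Q"
    then obtain x where x: "x \<in> A" "v = B +> x" by auto
    then have "v \<oplus>\<^bsub>Q\<^esub> (B +> (\<ominus>\<^bsub>V\<^esub> x)) = \<zero>\<^bsub>Q\<^esub>" using coset_zero AD(7) by (simp add: M.r_neg)
    then show "\<exists>w\<in>carrier Q. v \<oplus>\<^bsub>Q\<^esub> w = \<zero>\<^bsub>Q\<^esub>" using AD(5)[OF x(1)] by auto
  qed
  show "\<forall>c v. c \<in> carrier K \<and> v \<in> carrier Q \<longrightarrow> c \<odot>\<^bsub>Q\<^esub> v \<in> carrier Q"
    using AD(4) by auto
  show "\<forall>v w. v \<in> carrier Q \<and> w \<in> carrier Q \<longrightarrow> v \<oplus>\<^bsub>Q\<^esub> w = w \<oplus>\<^bsub>Q\<^esub> v"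
    by (auto simp: M.a_comm)
  show "\<forall>v w x. v \<in> carrier Q \<and> w \<in> carrier Q \<and> x \<in> carrier Q \<longrightarrow>
      v \<oplus>\<^bsub>Q\<^esub> w \<oplus>\<^bsub>Q\<^esub> x = v \<oplus>\<^bsub>Q\<^esub> (w \<oplus>\<^bsub>Q\<^esub> x)"
    by (auto simp: M.a_assoc)
  show "\<forall>v\<in>carrier Q. v \<oplus>\<^bsub>Q\<^esub> \<zero>\<^bsub>Q\<^esub> = v"
  proof
    fix v assume "v \<in> carrier Q"
    then obtain x where x: "x \<in> A" "v = B +> x" by auto
    have "(B +> x) <+>\<^bsub>V\<^esub> (B +> \<zero>\<^bsub>V\<^esub>) = B +> x" using x(1) by simp
    then show "v \<oplus>\<^bsub>Q\<^esub> \<zero>\<^bsub>Q\<^esub> = v" using coset_zero x by simp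
  qed
  show "\<forall>a b v. a \<in> carrier K \<and> b \<in> carrier K \<and> v \<in> carrier Q \<longrightarrow>
      a \<otimes>\<^bsub>K\<^esub> b \<odot>\<^bsub>Q\<^esub> v = a \<odot>\<^bsub>Q\<^esub> (b \<odot>\<^bsub>Q\<^esub> v)"
    by (auto simp: smult_assoc1)
  show "\<forall>v\<in>carrier Q. \<one>\<^bsub>K\<^esub> \<odot>\<^bsub>Q\<^esub> v = v"
    by auto
  show "\<forall>a b v. a \<in> carrier K \<and> b \<in> carrier K \<and> v \<in> carrier Q \<longrightarrow>
      (a \<oplus>\<^bsub>K\<^esub> b) \<odot>\<^bsub>Q\<^esub> v = a \<odot>\<^bsub>Q\<^esub> v \<oplus>\<^bsub>Q\<^esub> b \<odot>\<^bsub>Q\<^esub> v"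
    by (auto simp: smult_l_distr)
  show "\<forall>a v w. a \<in> carrier K \<and> v \<in> carrier Q \<and> w \<in> carrier Q \<longrightarrow>
      a \<odot>\<^bsub>Q\<^esub> (v \<oplus>\<^bsub>Q\<^esub> w) = a \<odot>\<^bsub>Q\<^esub> v \<oplus>\<^bsub>Q\<^esub> a \<odot>\<^bsub>Q\<^esub> w"
    by (auto simp: smult_r_distr)
qed

text \<open>Rank-nullity for the coset map: by \<open>coset_eq_self_iff\<close>, its kernel on
  \<open>S\<close> is \<open>S \<inter> B\<close>.\<close>

lemma
  assumes fd: fin_dim
  shows sdim_image: "\<And>S. subspace K S V \<Longrightarrow> S \<subseteq> A \<Longrightarrow>
      vectorspace.sdim K Q ((\<lambda>x. B +> x) ` S) + sdim (S \<inter> B) = sdim S"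
    and fin_dim_subquotient: "vectorspace.fin_dim K Q"
proof -
  have lin: "\<And>v. v \<in> A \<Longrightarrow> B +> v \<in> carrier Q"
    "\<And>v w. v \<in> A \<Longrightarrow> w \<in> A \<Longrightarrow> B +> (v \<oplus> w) = (B +> v) \<oplus>\<^bsub>Q\<^esub> (B +> w)"
    "\<And>c v. c \<in> carrier K \<Longrightarrow> v \<in> A \<Longrightarrow> B +> (c \<odot>\<^bsub>V\<^esub> v) = c \<odot>\<^bsub>Q\<^esub> (B +> v)"
    by (auto simp: coset_add[OF B] coset_smult[OF B] A_carrier)
  note * = vectorspace_axioms subquotient_vectorspace fd
  show "vectorspace.sdim K Q ((\<lambda>x. B +> x) ` S) + sdim (S \<inter> B) = sdim S"
    if S: "subspace K S V" and SA: "S \<subseteq> A" for S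
  proof -
    have "{v \<in> S. B +> v = B} = S \<inter> B"
      using coset_eq_self_iff[OF B] A_carrier SA by auto
    then show ?thesis
      using linear_map_sdim(1)[OF * S, of "\<lambda>x. B +> x"] lin SA by (simp add: subset_iff)
  qed
  show "vectorspace.fin_dim K Q"
    by (rule linear_map_sdim(2)[OF * A, of "\<lambda>x. B +> x", OF lin]) simp_all
qed

lemma subspace_image:
  assumes S: "subspace K S V" and SA: "S \<subseteq> A"
  shows "subspace K ((\<lambda>x. B +> x) ` S) Q"
proof -
  interpret Q: vectorspace K Q by (rule subquotient_vectorspace)
  note SD = subspaceD[OF S]
  note [simp] = coset_add[OF B] coset_smult[OF B] SD(7)
  show ?thesis
  proof (rule Q.subspaceI)
    show "\<zero>\<^bsub>Q\<^esub> \<in> (\<lambda>x. B +> x) ` S"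
      using coset_zero SD(2) by (auto intro!: image_eqI[of _ _ "\<zero>\<^bsub>V\<^esub>"])
  qed (use SA SD(3,4) in auto)
qed

lemma dim_subquotient:
  assumes fd: fin_dim
  shows "vectorspace.dim K Q + sdim B = sdim A"
proof -
  interpret Q: vectorspace K Q by (rule subquotient_vectorspace)
  have "A \<inter> B = B" using BA by blast
  then show ?thesis using sdim_image[OF fd A] Q.sdim_carrier by simp
qed

end

context vectorspace
begin

text \<open>The second isomorphism theorem: \<open>S\<close> maps onto the quotient of the sum by
  \<open>T\<close> with kernel \<open>S \<inter> T\<close>, so the dimension of this quotient can be
  counted in two ways.\<close>

lemma sdim_add:
  assumes fd: fin_dim and S: "subspace K S V" and T: "subspace K T V"
  shows "sdim (S <+>\<^bsub>V\<^esub> T) + sdim (S \<inter> T) = sdim S + sdim T"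
proof -
  note SD = subspaceD[OF S] and TD = subspaceD[OF T]
  have sub: "S \<subseteq> S <+>\<^bsub>V\<^esub> T" "T \<subseteq> S <+>\<^bsub>V\<^esub> T"
    unfolding set_add_def' using SD(2) TD(2) SD(7) TD(7) by force+
  interpret sq: subquotient_space K V "S <+>\<^bsub>V\<^esub> T" T
    by (intro subquotient_space.intro subquotient_space_axioms.intro vectorspace_axioms
        subspace_set_add[OF S T] T sub(2))
  interpret Q: vectorspace K sq.Q by (rule sq.subquotient_vectorspace)
  have "(\<lambda>x. T +>\<^bsub>V\<^esub> x) ` S = carrier sq.Q"
  proof
    show "carrier sq.Q \<subseteq> (\<lambda>x. T +>\<^bsub>V\<^esub> x) ` S"
    proof
      fix X assume "X \<in> carrier sq.Q"
      then obtain s t where st: "s \<in> S" "t \<in> T" "X = T +>\<^bsub>V\<^esub> (s \<oplus>\<^bsub>V\<^esub> t)"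
        unfolding set_add_def' by auto
      then have "X = (T +>\<^bsub>V\<^esub> s) <+>\<^bsub>V\<^esub> (T +>\<^bsub>V\<^esub> t)"
        using coset_add[OF T] SD(7) TD(7) by simp
      also have "T +>\<^bsub>V\<^esub> t = T +>\<^bsub>V\<^esub> \<zero>\<^bsub>V\<^esub>"
        using coset_eq_self_iff[OF T TD(7)[OF st(2)]] st(2) sq.coset_zero by metis
      finally have "X = T +>\<^bsub>V\<^esub> s" using coset_add[OF T] SD(7) st by simp
      then show "X \<in> (\<lambda>x. T +>\<^bsub>V\<^esub> x) ` S" using st by simp
    qed
  qed (use sub in auto)
  then show ?thesis
    using sq.sdim_image[OF fd S sub(1)] sq.dim_subquotient[OF fd] Q.sdim_carrier by simp
qed

end

text \<open>The step \<open>H q\<close> of the filtration that \<open>G\<close> induces on the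
  graded piece has dimension \<open>sdim (F p \<inter> G q) - sdim (F (p + 1) \<inter> G q)\<close>;
  subtracting the same expression for \<open>q + 1\<close> gives the four terms. The equation is
  stated over the reals because subtraction of natural numbers truncates.\<close>

lemma gr_gr_dim_eq:
  fixes V :: "(complex, 'v, 'm) module_scheme"
  assumes V: "vectorspace complex_field V" and fd: "vectorspace.fin_dim complex_field V"
    and F: "decreasing_filtration complex_field V F" and G: "decreasing_filtration complex_field V G"
  shows "real (gr_gr_dim V F G p q) =
    real (vectorspace.sdim complex_field V (F p \<inter> G q))
    - real (vectorspace.sdim complex_field V (F (p + 1) \<inter> G q))
    - real (vectorspace.sdim complex_field V (F p \<inter> G (q + 1)))
    + real (vectorspace.sdim complex_field V (F (p + 1) \<inter> G (q + 1)))"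
proof -
  interpret V: vectorspace complex_field V by fact
  have Fs: "subspace complex_field (F p) V" "F (p + 1) \<subseteq> F p" for p
    using F by (auto simp: decreasing_filtration_def)
  have Gs: "subspace complex_field (G q) V" "G (q + 1) \<subseteq> G q" for q
    using G by (auto simp: decreasing_filtration_def)
  interpret sq: subquotient_space complex_field V "F p" "F (p + 1)"
    by (rule subquotient_space.intro[OF V subquotient_space_axioms.intro[OF Fs(1) Fs(1) Fs(2)]])
  interpret Q: vectorspace complex_field sq.Q by (rule sq.subquotient_vectorspace)
  have fdQ: "Q.fin_dim" by (rule sq.fin_dim_subquotient[OF fd])
  define H where "H q = (\<lambda>x. F (p + 1) +>\<^bsub>V\<^esub> x) ` (G q \<inter> F p)" for q
  have sub: "subspace complex_field (G q \<inter> F p) V" for q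
    by (rule V.subspace_Int[OF Gs(1) Fs(1)])
  have H: "Q.sdim (H q) + V.sdim (F (p + 1) \<inter> G q) = V.sdim (F p \<inter> G q)"
    "subspace complex_field (H q) sq.Q" for q
  proof -
    have "G q \<inter> F p \<inter> F (p + 1) = F (p + 1) \<inter> G q" using Fs(2)[of p] by blast
    then show "Q.sdim (H q) + V.sdim (F (p + 1) \<inter> G q) = V.sdim (F p \<inter> G q)"
      using sq.sdim_image[OF fd sub[of q]] by (simp add: H_def Int_commute)
    show "subspace complex_field (H q) sq.Q"
      unfolding H_def by (rule sq.subspace_image[OF sub]) simp
  qed
  have "H (q + 1) \<subseteq> H q" unfolding H_def using Gs(2)[of q] by blast
  then interpret sq2: subquotient_space complex_field sq.Q "H q" "H (q + 1)"
    by (rule subquotient_space.intro[OF Q.vectorspace_axioms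
          subquotient_space_axioms.intro[OF H(2) H(2)]])
  have "gr_gr_dim V F G p q + Q.sdim (H (q + 1)) = Q.sdim (H q)"
    using sq2.dim_subquotient[OF fdQ]
    by (simp add: gr_gr_dim_def gr_def gr_filtration_def induced_filtration_def H_def)
  then show ?thesis using H(1)[of q] H(1)[of "q + 1"] by simp
qed

section \<open>Opposed filtrations\<close>

text \<open>These are Deligne's \<open>n\<close>-opposed filtrations. Conjugation is left out: an
  arbitrary \<open>G\<close> stands for the conjugate filtration.\<close>

locale opposed_filtrations = vectorspace K V for K and V (structure) +
  fixes F G and n :: int
  assumes fd: fin_dim
    and F: "decreasing_filtration K V F" and G: "decreasing_filtration K V G"
    and sum_eq: "F p <+>\<^bsub>V\<^esub> G (n + 1 - p) = carrier V"
    and Int_eq: "F p \<inter> G (n + 1 - p) = {\<zero>\<^bsub>V\<^esub>}"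
begin

lemma F_subspace: "subspace K (F p) V" and F_anti: "p \<le> q \<Longrightarrow> F q \<subseteq> F p"
  and G_subspace: "subspace K (G p) V" and G_anti: "p \<le> q \<Longrightarrow> G q \<subseteq> G p"
  using F G by (auto simp: decreasing_filtration_def)

lemma Int_subspace: "subspace K (F p \<inter> G q) V"
  by (rule subspace_Int[OF F_subspace G_subspace])

lemma Int_eq_zero:
  assumes "p + q > n" shows "F p \<inter> G q = {\<zero>\<^bsub>V\<^esub>}"
proof -
  have "F p \<inter> G q \<subseteq> {\<zero>\<^bsub>V\<^esub>}" using Int_eq[of p] G_anti[of "n + 1 - p" q] assms by auto
  then show ?thesis using subspaceD(2)[OF Int_subspace] by blast
qed

text \<open>Decompose a vector along \<open>F (p + 1)\<close> and \<open>G (n - p)\<close>. As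
  \<open>p + q \<le> n\<close>, the second space lies in \<open>G q\<close>, so subtracting one
  component from the vector shows that the other lies in the missing filtration step too.\<close>

lemma Int_eq_sum:
  assumes pq: "p + q \<le> n"
  shows "F p \<inter> G q = (F (p + 1) \<inter> G q) <+>\<^bsub>V\<^esub> (F p \<inter> G (n - p))"
proof
  have sub: "F (p + 1) \<subseteq> F p" "G (n - p) \<subseteq> G q" using F_anti G_anti pq by auto
  show "(F (p + 1) \<inter> G q) <+>\<^bsub>V\<^esub> (F p \<inter> G (n - p)) \<subseteq> F p \<inter> G q"
    unfolding set_add_def' using sub subspaceD(3)[OF Int_subspace, of _ p q] by blast
  show "F p \<inter> G q \<subseteq> (F (p + 1) \<inter> G q) <+>\<^bsub>V\<^esub> (F p \<inter> G (n - p))"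
  proof
    fix x assume x: "x \<in> F p \<inter> G q"
    then have "x \<in> F (p + 1) <+>\<^bsub>V\<^esub> G (n - p)"
      using subspaceD(7)[OF Int_subspace] sum_eq[of "p + 1"] by force
    then obtain a b where ab: "a \<in> F (p + 1)" "b \<in> G (n - p)" "x = a \<oplus>\<^bsub>V\<^esub> b"
      unfolding set_add_def' by blast
    have car: "a \<in> carrier V" "b \<in> carrier V"
      using ab subspaceD(7)[OF F_subspace] subspaceD(7)[OF G_subspace] by auto
    have "a = x \<ominus>\<^bsub>V\<^esub> b"
      using ab(3) car by (simp add: M.minus_eq M.a_assoc M.r_neg)
    then have "a \<in> G q" using subspaceD(6)[OF G_subspace, of x q b] x ab(2) sub by blast
    have "b = x \<ominus>\<^bsub>V\<^esub> a"
      using ab(3) car by (simp add: M.minus_eq M.a_comm M.r_neg2 M.r_neg1)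
    then have "b \<in> F p" using subspaceD(6)[OF F_subspace, of x p a] x ab(1) sub by blast
    show "x \<in> (F (p + 1) \<inter> G q) <+>\<^bsub>V\<^esub> (F p \<inter> G (n - p))"
      unfolding set_add_def' using ab \<open>a \<in> G q\<close> \<open>b \<in> F p\<close> by blast
  qed
qed

text \<open>The sum in \<open>Int_eq_sum\<close> is direct, because \<open>F (p + 1)\<close> and
  \<open>G (n - p)\<close> meet in zero.\<close>

lemma sdim_Int:
  assumes pq: "p + q \<le> n"
  shows "sdim (F p \<inter> G q) = sdim (F (p + 1) \<inter> G q) + sdim (F p \<inter> G (n - p))"
proof -
  have "F (p + 1) \<inter> G q \<inter> (F p \<inter> G (n - p)) \<subseteq> F (p + 1) \<inter> G (n - p)" by blast
  then have "F (p + 1) \<inter> G q \<inter> (F p \<inter> G (n - p)) \<subseteq> {\<zero>\<^bsub>V\<^esub>}"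
    using Int_eq_zero[of "p + 1" "n - p"] by simp
  then have "F (p + 1) \<inter> G q \<inter> (F p \<inter> G (n - p)) = {\<zero>\<^bsub>V\<^esub>}"
    using subspaceD(2)[OF subspace_Int[OF Int_subspace Int_subspace]] by blast
  then show ?thesis
    using sdim_add[OF fd Int_subspace Int_subspace, of "p + 1" q p "n - p"]
    by (simp add: Int_eq_sum[OF pq] sdim_zero)
qed

text \<open>In other words, the bigraded pieces vanish off the diagonal \<open>p + q = n\<close>.
  Beyond the diagonal all four intersections are zero. Before it, \<open>sdim_Int\<close> applies to
  \<open>q\<close> and to \<open>q + 1\<close>, with a second summand that does not depend on
  \<open>q\<close>.\<close>

lemma sdim_second_difference:
  assumes "p + q \<noteq> n"
  shows "sdim (F p \<inter> G q) + sdim (F (p + 1) \<inter> G (q + 1)) =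
    sdim (F (p + 1) \<inter> G q) + sdim (F p \<inter> G (q + 1))"
proof (cases "p + q > n")
  case True
  then show ?thesis by (simp add: Int_eq_zero)
next
  case False
  then show ?thesis using sdim_Int[of p q] sdim_Int[of p "q + 1"] assms by simp
qed

text \<open>By \<open>Int_eq_sum\<close>, each intersection before the diagonal is the sum of one
  that is a step closer to the diagonal and of one on it. This allows an induction on the distance
  \<open>n - p - q\<close>.\<close>

lemma Int_subset_if_diagonal:
  assumes P: "\<And>p q. subspace K (P p q) V"
    and anti: "\<And>p q p' q'. p \<le> p' \<Longrightarrow> q \<le> q' \<Longrightarrow> P p' q' \<subseteq> P p q"
    and diag: "\<And>p q. p + q = n \<Longrightarrow> F p \<inter> G q \<subseteq> P p q"
  shows "F p \<inter> G q \<subseteq> P p q"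
\<comment> \<open>Truncation by \<open>nat\<close> puts all pairs with \<open>p + q \<ge> n\<close>
  into the base case, where the intersection is diagonal or zero.\<close>
proof (induction "nat (n - p - q)" arbitrary: p q)
  case 0
  show ?case
  proof (cases "p + q = n")
    case True
    then show ?thesis by (rule diag)
  next
    case False
    with 0 have "p + q > n" by simp
    then show ?thesis using Int_eq_zero subspaceD(2)[OF P] by simp
  qed
next
  case (Suc m)
  then have pq: "p + q \<le> n" "m = nat (n - (p + 1) - q)" by simp_all
  have "F (p + 1) \<inter> G q \<subseteq> P p q" using Suc(1)[OF pq(2)] anti[of p "p + 1" q q] by simp
  moreover have "F p \<inter> G (n - p) \<subseteq> P p q"
    using diag[of p "n - p"] anti[of p p q "n - p"] pq(1) by simp
  ultimately show ?case
    unfolding Int_eq_sum[OF pq(1)] unfolding set_add_def' using subspaceD(3)[OF P, of _ p q] by blast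
qed

end

section \<open>Summation by parts over integer intervals\<close>

lemma sum_int_telescope:
  fixes u :: "int \<Rightarrow> 'a::ab_group_add"
  assumes "a \<le> b + 1"
  shows "(\<Sum>p\<in>{a..b}. u p - u (p + 1)) = u a - u (b + 1)"
proof -
  \<comment> \<open>The exclusive upper end \<open>c\<close> makes the empty interval the base of
    the induction.\<close>
  have "(\<Sum>p\<in>{a..c - 1}. u p - u (p + 1)) = u a - u c" if "a \<le> c" for c
    using that
  proof (induction c rule: int_ge_induct)
    case (step c)
    have "{a..c + 1 - 1} = insert c {a..c - 1}" using step(1) by auto
    then show ?case using step by simp
  qed simp
  from this[OF assms] show ?thesis by simp
qed

text \<open>The difference of the two sides telescopes along \<open>g (p - 1) * f p\<close>, which
  vanishes at both ends.\<close>

lemma sum_by_parts_int: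
  fixes f g :: "int \<Rightarrow> 'a::comm_ring"
  assumes "a \<le> b + 1" "f a = 0" "f (b + 1) = 0"
  shows "(\<Sum>p\<in>{a..b}. g p * (f p - f (p + 1))) = (\<Sum>p\<in>{a..b}. (g p - g (p - 1)) * f p)"
proof -
  have "(\<Sum>p\<in>{a..b}. g p * (f p - f (p + 1))) - (\<Sum>p\<in>{a..b}. (g p - g (p - 1)) * f p) =
      (\<Sum>p\<in>{a..b}. g (p - 1) * f p - g (p + 1 - 1) * f (p + 1))"
    unfolding sum_subtractf[symmetric] by (rule sum.cong) (simp_all add: algebra_simps)
  also have "\<dots> = 0" using sum_int_telescope[OF assms(1), of "\<lambda>p. g (p - 1) * f p"] assms(2,3) by simp
  finally show ?thesis by simp
qed

text \<open>Summation by parts in \<open>p\<close> replaces the square by its backward difference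
  \<open>2 * (p + q) - 1\<close>, and summation by parts in \<open>q\<close> replaces this by 2. The
  boundary terms vanish by the assumptions at \<open>a\<close> and \<open>b + 1\<close>.\<close>

lemma sum_square_second_difference:
  fixes f :: "int \<Rightarrow> int \<Rightarrow> real"
  assumes "a \<le> b + 1"
    and "\<And>q. f a q = 0" "\<And>q. f (b + 1) q = 0" "\<And>p. f p a = 0" "\<And>p. f p (b + 1) = 0"
  shows "(\<Sum>p\<in>{a..b}. \<Sum>q\<in>{a..b}.
      (real_of_int (p + q))\<^sup>2 * (f p q - f (p + 1) q - f p (q + 1) + f (p + 1) (q + 1))) =
    2 * (\<Sum>p\<in>{a..b}. \<Sum>q\<in>{a..b}. f p q)"
    (is "?L = _")
proof -
  have "?L = (\<Sum>q\<in>{a..b}. \<Sum>p\<in>{a..b}. (real_of_int (p + q))\<^sup>2 *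
      ((f p q - f p (q + 1)) - (f (p + 1) q - f (p + 1) (q + 1))))"
    by (subst sum.swap) (simp add: algebra_simps)
  also have "\<dots> = (\<Sum>q\<in>{a..b}. \<Sum>p\<in>{a..b}.
      ((real_of_int (p + q))\<^sup>2 - (real_of_int (p - 1 + q))\<^sup>2) * (f p q - f p (q + 1)))"
    by (intro sum.cong refl sum_by_parts_int) (simp_all add: assms)
  also have "\<dots> = (\<Sum>p\<in>{a..b}. \<Sum>q\<in>{a..b}. (2 * real_of_int (p + q) - 1) * (f p q - f p (q + 1)))"
    by (subst sum.swap) (intro sum.cong refl, simp add: power2_eq_square algebra_simps)
  also have "\<dots> = (\<Sum>p\<in>{a..b}. \<Sum>q\<in>{a..b}.
      ((2 * real_of_int (p + q) - 1) - (2 * real_of_int (p + (q - 1)) - 1)) * f p q)"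
    by (intro sum.cong refl sum_by_parts_int) (simp_all add: assms)
  also have "\<dots> = 2 * (\<Sum>p\<in>{a..b}. \<Sum>q\<in>{a..b}. f p q)"
    unfolding sum_distrib_left by (intro sum.cong refl) simp
  finally show ?thesis .
qed

section \<open>Complex conjugation\<close>

context complexification
begin

lemma iota_zero: "\<iota> \<zero>\<^bsub>HQ\<^esub> = \<zero>\<^bsub>HC\<^esub>"
  using \<iota>_smult[of "\<zero>\<^bsub>HQ\<^esub>" 0] HC.lmult_0[OF \<iota>_closed[of "\<zero>\<^bsub>HQ\<^esub>"]] HQ.lmult_0[of "\<zero>\<^bsub>HQ\<^esub>"] by simp

lemma iota_lincomb:
  assumes "finite A" "A \<subseteq> carrier HQ" "inj_on \<iota> A"
  shows "\<iota> (HQ.lincomb r A) = HC.lincomb (\<lambda>c. of_rat (r (the_inv_into A \<iota> c))) (\<iota> ` A)"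
proof -
  \<comment> \<open>The inverse is taken on all of \<open>A\<close> while the induction runs over
    subsets \<open>C\<close>, so the coefficient function stays the same throughout.\<close>
  have "\<iota> (HQ.lincomb r C) = HC.lincomb (\<lambda>c. of_rat (r (the_inv_into A \<iota> c))) (\<iota> ` C)"
    if "finite C" "C \<subseteq> A" for C
    using that
  proof (induction C rule: finite_induct)
    case empty
    then show ?case by (simp add: iota_zero)
  next
    case (insert x C)
    have x: "x \<in> carrier HQ" "C \<subseteq> carrier HQ" "\<iota> ` C \<subseteq> carrier HC" "\<iota> x \<in> carrier HC"
      using insert assms(2) \<iota>_closed by auto
    have nin: "\<iota> x \<notin> \<iota> ` C" using insert assms(3) by (auto dest: inj_onD)
    have "\<iota> (HQ.lincomb r (insert x C)) = \<iota> (r x \<odot>\<^bsub>HQ\<^esub> x) \<oplus>\<^bsub>HC\<^esub> \<iota> (HQ.lincomb r C)"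
      using HQ.lincomb_insert2[OF insert(1) x(2) _ insert(2) x(1), of r] x
      by (simp add: \<iota>_add HQ.lincomb_closed)
    also have "\<iota> (r x \<odot>\<^bsub>HQ\<^esub> x) = of_rat (r (the_inv_into A \<iota> (\<iota> x))) \<odot>\<^bsub>HC\<^esub> \<iota> x"
      using \<iota>_smult[OF x(1)] the_inv_into_f_f[OF assms(3)] insert(4) by simp
    finally show ?case
      using HC.lincomb_insert2[OF finite_imageI[OF insert(1)] x(3) _ nin x(4)] insert by simp
  qed
  from this[OF assms(1)] show ?thesis by simp
qed

text \<open>The property in the definite description of \<open>conjugation\<close>, named so that
  existence and uniqueness can be stated.\<close>

definition is_conjugation :: "('c \<Rightarrow> 'c) \<Rightarrow> bool" where
  "is_conjugation \<sigma> \<longleftrightarrow> \<sigma> \<in> carrier HC \<rightarrow>\<^sub>E carrier HC \<and>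
     (\<forall>x\<in>carrier HC. \<forall>y\<in>carrier HC. \<sigma> (x \<oplus>\<^bsub>HC\<^esub> y) = \<sigma> x \<oplus>\<^bsub>HC\<^esub> \<sigma> y) \<and>
     (\<forall>c. \<forall>v\<in>carrier HQ. \<sigma> (c \<odot>\<^bsub>HC\<^esub> \<iota> v) = cnj c \<odot>\<^bsub>HC\<^esub> \<iota> v)"

lemma is_conjugation_lincomb:
  assumes \<sigma>: "is_conjugation \<sigma>" and C: "finite C" "C \<subseteq> \<iota> ` carrier HQ"
  shows "\<sigma> (HC.lincomb a C) = HC.lincomb (\<lambda>c. cnj (a c)) C"
  using C
proof (induction C rule: finite_induct)
  case empty
  \<comment> \<open>That zero goes to zero is read off from the rule for scalar multiples, with
    scalar 0.\<close>
  have "\<sigma> (0 \<odot>\<^bsub>HC\<^esub> \<iota> \<zero>\<^bsub>HQ\<^esub>) = cnj 0 \<odot>\<^bsub>HC\<^esub> \<iota> \<zero>\<^bsub>HQ\<^esub>"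
    using \<sigma> unfolding is_conjugation_def by blast
  then show ?case using HC.lmult_0[OF \<iota>_closed[of "\<zero>\<^bsub>HQ\<^esub>"]] by simp
next
  case (insert x C)
  have x: "C \<subseteq> carrier HC" "x \<in> carrier HC" using insert \<iota>_closed by auto
  have "\<sigma> (HC.lincomb a (insert x C)) = \<sigma> (a x \<odot>\<^bsub>HC\<^esub> x) \<oplus>\<^bsub>HC\<^esub> \<sigma> (HC.lincomb a C)"
    using HC.lincomb_insert2[OF insert(1) x(1) _ insert(2) x(2), of a] x \<sigma>
    by (simp add: is_conjugation_def HC.lincomb_closed)
  also have "\<sigma> (a x \<odot>\<^bsub>HC\<^esub> x) = cnj (a x) \<odot>\<^bsub>HC\<^esub> x"
    using \<sigma> insert(4) unfolding is_conjugation_def by auto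
  finally show ?case
    using HC.lincomb_insert2[OF insert(1) x(1) _ insert(2) x(2), of "\<lambda>c. cnj (a c)"] insert by simp
qed

text \<open>A rational basis maps to a complex basis, and conjugating coordinates with respect to it
  gives the map. Uniqueness follows from \<open>is_conjugation_lincomb\<close> on the carrier and
  from extensionality outside.\<close>

lemma is_conjugation_ex1:
  assumes fd: "HQ.fin_dim"
  shows "\<exists>!\<sigma>. is_conjugation \<sigma>"
proof -
  obtain B where B: "finite B" "HQ.basis B" using HQ.finite_basis_exists[OF fd] by blast
  have BQ: "B \<subseteq> carrier HQ" "HQ.span B = carrier HQ" using B(2) by (auto simp: HQ.basis_def)
  have inj: "inj_on \<iota> B" and bas: "HC.basis (\<iota> ` B)" using \<iota>_basis[OF B(2)] by auto
  let ?C = "\<iota> ` B"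
  have C: "finite ?C" "?C \<subseteq> carrier HC" "?C \<subseteq> \<iota> ` carrier HQ" using B BQ \<iota>_closed by auto
  have span: "\<exists>a. x = HC.lincomb a ?C" if "x \<in> carrier HC" for x
    using HC.finite_in_span[OF C(1,2), of x] bas that by (auto simp: HC.basis_def)
  \<comment> \<open>A linear combination determines its coefficient function on \<open>?C\<close>
    only, hence the restrictions.\<close>
  have uniq: "restrict a ?C = restrict b ?C" if "HC.lincomb a ?C = HC.lincomb b ?C" for a b
  proof -
    have "\<exists>!c. c \<in> ?C \<rightarrow>\<^sub>E carrier complex_field \<and> HC.lincomb c ?C = HC.lincomb a ?C"
      using HC.basis_criterion[OF C(1,2)] bas C(2) HC.lincomb_closed[OF C(2), of a] by simp
    moreover have "HC.lincomb (restrict c ?C) ?C = HC.lincomb c ?C" for c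
      using C(2) by (intro HC.lincomb_cong) auto
    ultimately show ?thesis using that by (metis (no_types, lifting) PiE_restrict UNIV_I
          partial_object.select_convs(1) restrict_PiE_iff)
  qed
  define coef where "coef x = (SOME a. x = HC.lincomb a ?C)" for x
  define \<sigma> where "\<sigma> x = (if x \<in> carrier HC then HC.lincomb (\<lambda>c. cnj (coef x c)) ?C else undefined)" for x
  have \<sigma>_lincomb: "\<sigma> (HC.lincomb a ?C) = HC.lincomb (\<lambda>c. cnj (a c)) ?C" for a
  proof -
    have "HC.lincomb a ?C = HC.lincomb (coef (HC.lincomb a ?C)) ?C"
      unfolding coef_def by (rule someI[of _ a]) simp
    from uniq[OF this] have "coef (HC.lincomb a ?C) c = a c" if "c \<in> ?C" for c
      using that by (metis restrict_apply')
    then have "HC.lincomb (\<lambda>c. cnj (coef (HC.lincomb a ?C) c)) ?C = HC.lincomb (\<lambda>c. cnj (a c)) ?C"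
      using C(2) by (intro HC.lincomb_cong) auto
    then show ?thesis using HC.lincomb_closed[OF C(2), of a] by (simp add: \<sigma>_def)
  qed
  have "is_conjugation \<sigma>"
    unfolding is_conjugation_def
  proof (intro conjI ballI allI)
    show "\<sigma> \<in> carrier HC \<rightarrow>\<^sub>E carrier HC"
      using HC.lincomb_closed[OF C(2)] by (auto simp: \<sigma>_def)
    show "\<sigma> (x \<oplus>\<^bsub>HC\<^esub> y) = \<sigma> x \<oplus>\<^bsub>HC\<^esub> \<sigma> y" if x: "x \<in> carrier HC" and y: "y \<in> carrier HC" for x y
    proof -
      obtain a b where ab: "x = HC.lincomb a ?C" "y = HC.lincomb b ?C" using span x y by blast
      have sum: "HC.lincomb (\<lambda>c. a c + b c) ?C = HC.lincomb a ?C \<oplus>\<^bsub>HC\<^esub> HC.lincomb b ?C" for a b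
        using HC.lincomb_sum[OF C(1,2), of a b] by simp
      have "\<sigma> (x \<oplus>\<^bsub>HC\<^esub> y) = HC.lincomb (\<lambda>c. cnj (a c + b c)) ?C"
        unfolding ab sum[symmetric] \<sigma>_lincomb ..
      then show ?thesis using sum[of "\<lambda>c. cnj (a c)" "\<lambda>c. cnj (b c)"] by (simp add: ab \<sigma>_lincomb)
    qed
    show "\<sigma> (k \<odot>\<^bsub>HC\<^esub> \<iota> v) = cnj k \<odot>\<^bsub>HC\<^esub> \<iota> v" if v: "v \<in> carrier HQ" for k v
    proof -
      obtain r where r: "HQ.lincomb r B = v"
        using HQ.finite_in_span[OF B(1) BQ(1), of v] BQ(2) v by auto
      define s where "s c = (of_rat (r (the_inv_into B \<iota> c)) :: complex)" for c
      have \<iota>v: "\<iota> v = HC.lincomb s ?C" using iota_lincomb[OF B(1) BQ(1) inj, of r] r unfolding s_def by simp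
      have smult: "HC.lincomb (\<lambda>c. k * a c) ?C = k \<odot>\<^bsub>HC\<^esub> HC.lincomb a ?C" for k a
        using HC.lincomb_smult[OF C(2), of a k] by simp
      \<comment> \<open>The coordinates of \<open>\<iota> v\<close> are rational and therefore fixed
        by complex conjugation.\<close>
      have "cnj (s c) = s c" for c unfolding s_def by (cases "r (the_inv_into B \<iota> c)") (simp add: of_rat_rat)
      then have "(\<lambda>c. cnj (k * s c)) = (\<lambda>c. cnj k * s c)" by simp
      then show ?thesis unfolding \<iota>v smult[symmetric] \<sigma>_lincomb by simp
    qed
  qed
  moreover have "\<tau> = \<sigma>" if "is_conjugation \<tau>" for \<tau>
  proof
    fix x
    show "\<tau> x = \<sigma> x"
    proof (cases "x \<in> carrier HC")
      case True
      then obtain a where "x = HC.lincomb a ?C" using span by blast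
      then show ?thesis using is_conjugation_lincomb[OF that C(1,3)] \<sigma>_lincomb by simp
    next
      case False
      then show ?thesis using that by (auto simp: is_conjugation_def \<sigma>_def PiE_def extensional_def)
    qed
  qed
  ultimately show ?thesis by blast
qed

section \<open>Conjugation as a semilinear involution\<close>

context
  assumes fd: "HQ.fin_dim"
begin

lemma is_conjugation_conjugation: "is_conjugation conjugation"
  unfolding conjugation_def using theI'[OF is_conjugation_ex1[OF fd]]
  unfolding is_conjugation_def .

lemmas conjugation_lincomb = is_conjugation_lincomb[OF is_conjugation_conjugation]

lemma conjugation_closed: "x \<in> carrier HC \<Longrightarrow> conjugation x \<in> carrier HC"
  using is_conjugation_conjugation by (auto simp: is_conjugation_def)

lemma conjugation_add:
  "x \<in> carrier HC \<Longrightarrow> y \<in> carrier HC \<Longrightarrow> conjugation (x \<oplus>\<^bsub>HC\<^esub> y) = conjugation x \<oplus>\<^bsub>HC\<^esub> conjugation y"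
  using is_conjugation_conjugation by (auto simp: is_conjugation_def)

text \<open>Reduces statements about arbitrary vectors to \<open>conjugation_lincomb\<close>, which
  needs combinations of rational vectors.\<close>

lemma carrier_lincomb:
  assumes "x \<in> carrier HC"
  obtains a C where "finite C" "C \<subseteq> \<iota> ` carrier HQ" "C \<subseteq> carrier HC" "x = HC.lincomb a C"
proof -
  obtain B where B: "finite B" "HQ.basis B" using HQ.finite_basis_exists[OF fd] by blast
  have "HC.basis (\<iota> ` B)" using \<iota>_basis[OF B(2)] by simp
  then have "\<iota> ` B \<subseteq> carrier HC" "HC.span (\<iota> ` B) = carrier HC" by (auto simp: HC.basis_def)
  then have "\<exists>a. HC.lincomb a (\<iota> ` B) = x"
    using HC.finite_in_span[of "\<iota> ` B" x] B assms by auto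
  moreover have "\<iota> ` B \<subseteq> \<iota> ` carrier HQ" using B by (auto simp: HQ.basis_def)
  ultimately show ?thesis using that B(1) \<open>\<iota> ` B \<subseteq> carrier HC\<close> by blast
qed

lemma conjugation_smult:
  assumes "x \<in> carrier HC"
  shows "conjugation (k \<odot>\<^bsub>HC\<^esub> x) = cnj k \<odot>\<^bsub>HC\<^esub> conjugation x"
proof -
  obtain a C where C: "finite C" "C \<subseteq> \<iota> ` carrier HQ" "C \<subseteq> carrier HC" and x: "x = HC.lincomb a C"
    using assms by (rule carrier_lincomb)
  have smult: "HC.lincomb (\<lambda>c. k * a c) C = k \<odot>\<^bsub>HC\<^esub> HC.lincomb a C" for k a
    using HC.lincomb_smult[OF C(3), of a k] by simp
  have "conjugation (k \<odot>\<^bsub>HC\<^esub> x) = HC.lincomb (\<lambda>c. cnj (k * a c)) C"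
    unfolding x smult[symmetric] by (rule conjugation_lincomb[OF C(1,2)])
  also have "\<dots> = cnj k \<odot>\<^bsub>HC\<^esub> conjugation x"
    unfolding x conjugation_lincomb[OF C(1,2)] smult[symmetric] by simp
  finally show ?thesis .
qed

lemma conjugation_conjugation:
  assumes "x \<in> carrier HC"
  shows "conjugation (conjugation x) = x"
proof -
  obtain a C where C: "finite C" "C \<subseteq> \<iota> ` carrier HQ" and x: "x = HC.lincomb a C"
    using assms by (rule carrier_lincomb)
  show ?thesis unfolding x conjugation_lincomb[OF C] by simp
qed

text \<open>Rational vectors are fixed, so only the coefficients get conjugated; the reverse
  inclusion holds because conjugation is an involution. This is why the complexified weight
  filtration is stable.\<close>

lemma conjugation_span:
  assumes "S \<subseteq> \<iota> ` carrier HQ"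
  shows "conjugation ` HC.span S = HC.span S"
proof -
  have sub: "HC.span S \<subseteq> carrier HC"
    using assms \<iota>_closed by (intro HC.span_is_subset2) auto
  have *: "conjugation x \<in> HC.span S" if "x \<in> HC.span S" for x
  proof -
    from that obtain a C where C: "finite C" "C \<subseteq> S" "x = HC.lincomb a C"
      unfolding HC.span_def by blast
    then have "conjugation x = HC.lincomb (\<lambda>c. cnj (a c)) C"
      using conjugation_lincomb[OF C(1)] assms by auto
    then show ?thesis unfolding HC.span_def using C by auto
  qed
  show ?thesis
  proof
    show "HC.span S \<subseteq> conjugation ` HC.span S"
    proof
      fix x assume "x \<in> HC.span S"
      then show "x \<in> conjugation ` HC.span S"
        using *[of x] sub conjugation_conjugation[of x] by (metis image_eqI subsetD)
    qed
  qed (use * in blast)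
qed

lemma conjugation_subspace:
  assumes "subspace complex_field S HC"
  shows "subspace complex_field (conjugation ` S) HC"
proof (rule HC.subspaceI)
  note SD = HC.subspaceD[OF assms]
  show "conjugation ` S \<subseteq> carrier HC" using conjugation_closed SD(7) by blast
  have "conjugation \<zero>\<^bsub>HC\<^esub> = \<zero>\<^bsub>HC\<^esub>"
    using conjugation_lincomb[of "{}" undefined] by simp
  then show "\<zero>\<^bsub>HC\<^esub> \<in> conjugation ` S" using SD(2) by (metis image_eqI)
  show "v \<oplus>\<^bsub>HC\<^esub> w \<in> conjugation ` S" if "v \<in> conjugation ` S" "w \<in> conjugation ` S" for v w
  proof -
    from that obtain x y where "x \<in> S" "y \<in> S" "v = conjugation x" "w = conjugation y" by blast
    then show ?thesis using SD(3)[of x y] SD(7) conjugation_add[of x y] by (metis image_eqI)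
  qed
  show "k \<odot>\<^bsub>HC\<^esub> v \<in> conjugation ` S" if "v \<in> conjugation ` S" for k v
  proof -
    from that obtain x where x: "x \<in> S" "v = conjugation x" by blast
    \<comment> \<open>The image under a semilinear map is closed under \<open>k\<close> because
      \<open>S\<close> is closed under \<open>cnj k\<close>.\<close>
    have "k \<odot>\<^bsub>HC\<^esub> v = conjugation (cnj k \<odot>\<^bsub>HC\<^esub> x)" using conjugation_smult[OF SD(7)[OF x(1)]] x by simp
    then show ?thesis using SD(4)[of "cnj k" x] x(1) by auto
  qed
qed

end

end

section \<open>The graded pieces of the weight filtration\<close>

context abelian_group
begin

lemma add_diff_cancel_left:
  "z \<in> carrier G \<Longrightarrow> w \<in> carrier G \<Longrightarrow> (z \<oplus> w) \<ominus> z = w"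
  by (simp add: minus_eq a_comm[of z w] a_assoc r_neg)

lemma add_diff_cancel_right:
  "z \<in> carrier G \<Longrightarrow> w \<in> carrier G \<Longrightarrow> (z \<oplus> w) \<ominus> w = z"
  by (simp add: minus_eq a_assoc r_neg)

lemma diff_add_cancel:
  "z \<in> carrier G \<Longrightarrow> w \<in> carrier G \<Longrightarrow> (z \<ominus> w) \<oplus> w = z"
  by (simp add: minus_eq a_assoc l_neg)

lemma diff_diff_swap:
  "x \<in> carrier G \<Longrightarrow> y \<in> carrier G \<Longrightarrow> z \<in> carrier G \<Longrightarrow> (x \<ominus> y) \<ominus> z = (x \<ominus> z) \<ominus> y"
  by (simp add: minus_eq a_ac)

text \<open>Bookkeeping for one correction step in \<open>deligne_I_lift\<close>: the part
  \<open>a\<close> of the difference is moved to \<open>x\<close>, the part \<open>b\<close> to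
  \<open>z\<close>, and the error \<open>c\<close> remains.\<close>

lemma diff_diff_add:
  assumes "x \<in> carrier G" "z \<in> carrier G" "a \<in> carrier G" "b \<in> carrier G" "c \<in> carrier G"
    and "x \<ominus> z = (a \<oplus> b) \<oplus> c"
  shows "(x \<ominus> a) \<ominus> (z \<oplus> b) = c"
proof -
  have "x = ((a \<oplus> b) \<oplus> c) \<oplus> z" using diff_add_cancel[of x z] assms by simp
  also have "\<dots> = ((z \<oplus> b) \<oplus> c) \<oplus> a" using assms(1-5) by (simp add: a_ac)
  finally show ?thesis
    using add_diff_cancel_right[of "(z \<oplus> b) \<oplus> c" a] add_diff_cancel_left[of "z \<oplus> b" c] assms(1-5) by simp
qed

end

context subquotient_space
begin

lemma decreasing_filtration_induced:
  assumes E: "decreasing_filtration K V E"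
  shows "decreasing_filtration K Q (induced_filtration V A B E)"
proof -
  have sub: "subspace K (E p) V" and anti: "p \<le> q \<Longrightarrow> E q \<subseteq> E p" for p q
    using E by (auto simp: decreasing_filtration_def)
  obtain a b where a: "E a = carrier V" and b: "E b = {\<zero>\<^bsub>V\<^esub>}"
    using E by (auto simp: decreasing_filtration_def)
  show ?thesis
    unfolding decreasing_filtration_def
  proof (intro conjI allI impI)
    show "subspace K (induced_filtration V A B E p) Q" for p
      unfolding induced_filtration_def by (intro subspace_image subspace_Int sub A) auto
    show "induced_filtration V A B E q \<subseteq> induced_filtration V A B E p" if "p \<le> q" for p q
      unfolding induced_filtration_def using anti[OF that] by blast
    have "E a \<inter> A = A" using a A_carrier by blast
    then show "\<exists>p. induced_filtration V A B E p = carrier Q"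
      by (intro exI[of _ a]) (simp add: induced_filtration_def)
    have "E b \<inter> A = {\<zero>\<^bsub>V\<^esub>}" using b subspaceD(2)[OF A] by blast
    then show "\<exists>p. induced_filtration V A B E p = {\<zero>\<^bsub>Q\<^esub>}"
      using coset_zero by (intro exI[of _ b]) (simp add: induced_filtration_def)
  qed
qed

end

section \<open>The filtrations of \<open>HC\<close> and their behaviour under conjugation\<close>

context pre_mixed_hodge_structure
begin

lemma HC_fin_dim: "HC.fin_dim"
proof -
  obtain B where B: "finite B" "HQ.basis B" using HQ.finite_basis_exists[OF HQ_fin_dim] by blast
  then have "HC.basis (\<iota> ` B)" using \<iota>_basis by blast
  then show ?thesis unfolding HC.fin_dim_def HC.basis_def using B(1) by blast
qed

lemma W_subset: "W n \<subseteq> carrier HQ"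
  using W_filtration HQ.subspaceD(1) by (auto simp: increasing_filtration_def)

lemma iota_W: "\<iota> ` W n \<subseteq> \<iota> ` carrier HQ" "\<iota> ` W n \<subseteq> carrier HC"
  using W_subset \<iota>_closed by blast+

lemma WC_subspace: "subspace complex_field (WC n) HC"
  unfolding WC_def by (rule HC.span_is_subspace[OF iota_W(2)])

lemma WC_mono: "m \<le> n \<Longrightarrow> WC m \<subseteq> WC n"
  unfolding WC_def using W_filtration
  by (intro HC.span_is_monotone image_mono) (simp add: increasing_filtration_def)

lemma WC_bounded: "\<exists>N. \<forall>n\<le>N. WC n = {\<zero>\<^bsub>HC\<^esub>}" "\<exists>N. \<forall>n\<ge>N. WC n = carrier HC"
proof -
  obtain a b where a: "W a = {\<zero>\<^bsub>HQ\<^esub>}" and b: "W b = carrier HQ"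
    using W_filtration by (auto simp: increasing_filtration_def)
  have "WC a \<subseteq> {\<zero>\<^bsub>HC\<^esub>}"
    unfolding WC_def a by (intro HC.span_is_subset HC.is_module HC.subspace_zero) (simp add: iota_zero)
  then have "WC n = {\<zero>\<^bsub>HC\<^esub>}" if "n \<le> a" for n
    using WC_mono[OF that] HC.subspaceD(2)[OF WC_subspace[of n]] by blast
  then show "\<exists>N. \<forall>n\<le>N. WC n = {\<zero>\<^bsub>HC\<^esub>}" by blast
  have "x \<in> WC b" if x: "x \<in> carrier HC" for x
  proof -
    obtain k C where "finite C" "C \<subseteq> \<iota> ` carrier HQ" "C \<subseteq> carrier HC" "x = HC.lincomb k C"
      using x by (rule carrier_lincomb[OF HQ_fin_dim])
    then show ?thesis unfolding WC_def HC.span_def b by auto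
  qed
  then have "WC n = carrier HC" if "n \<ge> b" for n
    using WC_mono[OF that] HC.subspaceD(1)[OF WC_subspace[of n]] by blast
  then show "\<exists>N. \<forall>n\<ge>N. WC n = carrier HC" by blast
qed

lemmas conj_closed = conjugation_closed[OF HQ_fin_dim]
  and conj_add = conjugation_add[OF HQ_fin_dim]
  and conj_conj = conjugation_conjugation[OF HQ_fin_dim]

lemma conj_WC: "conjugation ` WC n = WC n"
  unfolding WC_def by (rule conjugation_span[OF HQ_fin_dim iota_W(1)])

lemma conj_WC_mem: "x \<in> WC n \<Longrightarrow> conjugation x \<in> WC n"
  using conj_WC by blast

lemma F_subspace: "subspace complex_field (F p) HC" and F_anti: "p \<le> q \<Longrightarrow> F q \<subseteq> F p"
  using F_filtration by (auto simp: decreasing_filtration_def)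

lemma Fbar_subspace: "subspace complex_field (Fbar p) HC"
  unfolding Fbar_def by (rule conjugation_subspace[OF HQ_fin_dim F_subspace])

lemma Fbar_anti: "p \<le> q \<Longrightarrow> Fbar q \<subseteq> Fbar p"
  unfolding Fbar_def using F_anti by blast

lemma conj_zero: "conjugation \<zero>\<^bsub>HC\<^esub> = \<zero>\<^bsub>HC\<^esub>"
  using conjugation_lincomb[OF HQ_fin_dim, of "{}" undefined] by simp

lemma conj_carrier: "conjugation ` carrier HC = carrier HC"
  using conj_closed conj_conj by (metis image_eqI image_subsetI subsetI subset_antisym)

lemma Fbar_eq: "F p = carrier HC \<Longrightarrow> Fbar p = carrier HC"
  "F p = {\<zero>\<^bsub>HC\<^esub>} \<Longrightarrow> Fbar p = {\<zero>\<^bsub>HC\<^esub>}"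
  unfolding Fbar_def using conj_carrier conj_zero by simp_all

lemma Fbar_filtration: "decreasing_filtration complex_field HC Fbar"
proof -
  have "\<exists>p. F p = carrier HC" "\<exists>p. F p = {\<zero>\<^bsub>HC\<^esub>}"
    using F_filtration by (auto simp: decreasing_filtration_def)
  then show ?thesis
    unfolding decreasing_filtration_def using Fbar_subspace Fbar_anti Fbar_eq by blast
qed

lemma conj_F: "x \<in> F p \<Longrightarrow> conjugation x \<in> Fbar p"
  unfolding Fbar_def by blast

lemma conj_Fbar: "x \<in> Fbar p \<Longrightarrow> conjugation x \<in> F p"
  unfolding Fbar_def using conj_conj HC.subspaceD(7)[OF F_subspace] by force

lemma bounded:
  obtains M where "M \<ge> 0" "\<And>p. p \<le> - M \<Longrightarrow> F p = carrier HC" "\<And>p. p \<ge> M \<Longrightarrow> F p = {\<zero>\<^bsub>HC\<^esub>}"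
    "\<And>n. n \<le> - M \<Longrightarrow> WC n = {\<zero>\<^bsub>HC\<^esub>}" "\<And>n. n \<ge> M \<Longrightarrow> WC n = carrier HC"
proof -
  obtain a b where a: "F a = carrier HC" and b: "F b = {\<zero>\<^bsub>HC\<^esub>}"
    using F_filtration by (auto simp: decreasing_filtration_def)
  obtain c d where c: "\<forall>n\<le>c. WC n = {\<zero>\<^bsub>HC\<^esub>}" and d: "\<forall>n\<ge>d. WC n = carrier HC"
    using WC_bounded by blast
  show ?thesis
  \<comment> \<open>The sum of absolute values bounds all four indices at once, in both
    directions.\<close>
  proof (rule that[of "\<bar>a\<bar> + \<bar>b\<bar> + \<bar>c\<bar> + \<bar>d\<bar>"])
    show "F p = carrier HC" if "p \<le> - (\<bar>a\<bar> + \<bar>b\<bar> + \<bar>c\<bar> + \<bar>d\<bar>)" for p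
    proof -
      have "p \<le> a" using that by linarith
      then show ?thesis using F_anti[of p a] a HC.subspaceD(1)[OF F_subspace[of p]] by blast
    qed
    show "F p = {\<zero>\<^bsub>HC\<^esub>}" if "p \<ge> \<bar>a\<bar> + \<bar>b\<bar> + \<bar>c\<bar> + \<bar>d\<bar>" for p
    proof -
      have "b \<le> p" using that by linarith
      then show ?thesis using F_anti[of b p] b HC.subspaceD(2)[OF F_subspace[of p]] by blast
    qed
    show "WC n = {\<zero>\<^bsub>HC\<^esub>}" if "n \<le> - (\<bar>a\<bar> + \<bar>b\<bar> + \<bar>c\<bar> + \<bar>d\<bar>)" for n
    proof -
      have "n \<le> c" using that by linarith
      then show ?thesis using c by blast
    qed
    show "WC n = carrier HC" if "n \<ge> \<bar>a\<bar> + \<bar>b\<bar> + \<bar>c\<bar> + \<bar>d\<bar>" for n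
    proof -
      have "d \<le> n" using that by linarith
      then show ?thesis using d by blast
    qed
  qed simp
qed

section \<open>Projection to the graded pieces and classes that lift\<close>

abbreviation pr :: "int \<Rightarrow> 'c \<Rightarrow> 'c set" where
  "pr n x \<equiv> WC (n - 1) +>\<^bsub>HC\<^esub> x"

lemma subquotient_space_grW: "subquotient_space complex_field HC (WC n) (WC (n - 1))"
  using WC_mono[of "n - 1" n]
  by (intro subquotient_space.intro subquotient_space_axioms.intro HC.vectorspace_axioms WC_subspace) simp

lemmas grW_vectorspace = subquotient_space.subquotient_vectorspace[OF subquotient_space_grW, folded grW_def]
  and grW_fin_dim = subquotient_space.fin_dim_subquotient[OF subquotient_space_grW HC_fin_dim, folded grW_def]
  and sdim_pr_image = subquotient_space.sdim_image[OF subquotient_space_grW HC_fin_dim, folded grW_def]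
  and pr_image_subspace = subquotient_space.subspace_image[OF subquotient_space_grW, folded grW_def]
  and grW_filtration_decreasing =
    subquotient_space.decreasing_filtration_induced[OF subquotient_space_grW, folded grW_def]

lemma grW_filtration_eq: "grW_filtration n E p = pr n ` (E p \<inter> WC n)"
  by (simp add: grW_filtration_def induced_filtration_def)

lemma grW_carrier: "carrier (grW n) = pr n ` WC n"
  by (simp add: grW_def)

lemma grW_zero: "\<zero>\<^bsub>grW n\<^esub> = WC (n - 1)"
  by (simp add: grW_def)

lemma WC_carrier: "x \<in> WC n \<Longrightarrow> x \<in> carrier HC"
  using HC.subspaceD(7)[OF WC_subspace] .

lemma pr_eq_iff:
  "x \<in> WC n \<Longrightarrow> y \<in> WC n \<Longrightarrow> pr n x = pr n y \<longleftrightarrow> x \<ominus>\<^bsub>HC\<^esub> y \<in> WC (n - 1)"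
  by (intro HC.coset_eq_iff WC_subspace WC_carrier)

lemma pr_add:
  "x \<in> WC n \<Longrightarrow> y \<in> WC n \<Longrightarrow> pr n x \<oplus>\<^bsub>grW n\<^esub> pr n y = pr n (x \<oplus>\<^bsub>HC\<^esub> y)"
  by (simp add: grW_def HC.coset_add[OF WC_subspace] WC_carrier)

lemma conj_pr:
  assumes x: "x \<in> carrier HC"
  shows "conjugation ` pr n x = pr n (conjugation x)"
proof -
  have "conjugation ` pr n x = (\<lambda>b. conjugation b \<oplus>\<^bsub>HC\<^esub> conjugation x) ` WC (n - 1)"
    unfolding a_r_coset_def' using conj_add x WC_carrier[of _ "n - 1"] by (force simp: image_iff)
  also have "\<dots> = (\<lambda>b. b \<oplus>\<^bsub>HC\<^esub> conjugation x) ` conjugation ` WC (n - 1)"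
    by (simp add: image_image)
  also have "\<dots> = pr n (conjugation x)"
    unfolding conj_WC a_r_coset_def' by blast
  finally show ?thesis .
qed

lemma conj_F_Int_WC: "conjugation ` (F p \<inter> WC n) = Fbar p \<inter> WC n"
proof
  show "conjugation ` (F p \<inter> WC n) \<subseteq> Fbar p \<inter> WC n" using conj_F conj_WC_mem by blast
  show "Fbar p \<inter> WC n \<subseteq> conjugation ` (F p \<inter> WC n)"
  proof
    fix x assume x: "x \<in> Fbar p \<inter> WC n"
    then have "conjugation x \<in> F p \<inter> WC n" using conj_Fbar conj_WC_mem by blast
    moreover have "conjugation (conjugation x) = x" using x WC_carrier conj_conj by blast
    ultimately show "x \<in> conjugation ` (F p \<inter> WC n)" by (metis image_eqI)
  qed
qed

text \<open>Purity is assumed for conjugated cosets; with this equation it becomes a statement about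
  the filtrations that \<open>F\<close> and \<open>Fbar\<close> induce.\<close>

lemma conj_grW_filtration: "(\<lambda>X. conjugation ` X) ` grW_filtration n F p = grW_filtration n Fbar p"
proof -
  have "(\<lambda>X. conjugation ` X) ` grW_filtration n F p = (\<lambda>x. pr n (conjugation x)) ` (F p \<inter> WC n)"
    unfolding grW_filtration_eq image_image using WC_carrier by (intro image_cong refl conj_pr) blast
  also have "\<dots> = pr n ` conjugation ` (F p \<inter> WC n)"
    by (simp add: image_image)
  finally show ?thesis unfolding conj_F_Int_WC grW_filtration_eq .
qed

text \<open>One representative has to lie in both filtrations. A class in the intersection of the
  induced filtrations may need a different representative for each.\<close>

definition lifted :: "int \<Rightarrow> int \<Rightarrow> int \<Rightarrow> 'c set set" where
  "lifted n p q = pr n ` (F p \<inter> Fbar q \<inter> WC n)"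

lemma lifted_subset: "lifted n p q \<subseteq> grW_filtration n F p \<inter> grW_filtration n Fbar q"
  unfolding lifted_def grW_filtration_eq by blast

lemma FFbarW_subspace: "subspace complex_field (F p \<inter> Fbar q \<inter> WC n) HC"
  by (intro HC.subspace_Int F_subspace Fbar_subspace WC_subspace)

lemma lifted_subspace: "subspace complex_field (lifted n p q) (grW n)"
  unfolding lifted_def by (rule pr_image_subspace[OF FFbarW_subspace]) simp

lemma lifted_anti: "p \<le> p' \<Longrightarrow> q \<le> q' \<Longrightarrow> lifted n p' q' \<subseteq> lifted n p q"
  unfolding lifted_def using F_anti Fbar_anti by blast

definition grdim :: "int \<Rightarrow> int \<Rightarrow> int \<Rightarrow> real" where
  "grdim n p q = real (vectorspace.sdim complex_field (grW n)
     (grW_filtration n F p \<inter> grW_filtration n Fbar q))"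

definition defect :: "int \<Rightarrow> int \<Rightarrow> int \<Rightarrow> real" where
  "defect n p q = grdim n p q - real (vectorspace.sdim complex_field (grW n) (lifted n p q))"

lemma grW_filtration_subspace:
  "subspace complex_field (grW_filtration n F p \<inter> grW_filtration n Fbar q) (grW n)"
proof -
  interpret Gr: vectorspace complex_field "grW n" by (rule grW_vectorspace)
  show ?thesis unfolding grW_filtration_eq
    by (intro Gr.subspace_Int pr_image_subspace HC.subspace_Int F_subspace Fbar_subspace WC_subspace) auto
qed

lemma defect_nonneg: "defect n p q \<ge> 0"
proof -
  interpret Gr: vectorspace complex_field "grW n" by (rule grW_vectorspace)
  show ?thesis
    using Gr.sdim_mono[OF grW_fin_dim lifted_subspace grW_filtration_subspace lifted_subset]
    by (simp add: defect_def grdim_def)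
qed

text \<open>In finite dimension, a subspace of full dimension is the whole space.\<close>

lemma defect_eq_0_iff:
  "defect n p q = 0 \<longleftrightarrow> grW_filtration n F p \<inter> grW_filtration n Fbar q \<subseteq> lifted n p q"
proof -
  interpret Gr: vectorspace complex_field "grW n" by (rule grW_vectorspace)
  show ?thesis
  proof
    assume "defect n p q = 0"
    then have "Gr.sdim (lifted n p q) = Gr.sdim (grW_filtration n F p \<inter> grW_filtration n Fbar q)"
      by (simp add: defect_def grdim_def)
    from Gr.sdim_eq_imp_eq[OF grW_fin_dim lifted_subspace grW_filtration_subspace lifted_subset this]
    show "grW_filtration n F p \<inter> grW_filtration n Fbar q \<subseteq> lifted n p q" by simp
  next
    assume "grW_filtration n F p \<inter> grW_filtration n Fbar q \<subseteq> lifted n p q"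
    then have "grW_filtration n F p \<inter> grW_filtration n Fbar q = lifted n p q"
      using lifted_subset by (rule subset_antisym)
    then show "defect n p q = 0" by (simp add: defect_def grdim_def)
  qed
qed

text \<open>If one of the two spaces is everything, it contains the representative chosen in the
  other. If one is zero, its representative is zero and lies in the other. This supplies the
  boundary conditions for the summation by parts.\<close>

lemma defect_extreme:
  assumes "F p = carrier HC \<or> F p = {\<zero>\<^bsub>HC\<^esub>} \<or> Fbar q = carrier HC \<or> Fbar q = {\<zero>\<^bsub>HC\<^esub>}"
  shows "defect n p q = 0"
  unfolding defect_eq_0_iff
proof
  fix X assume "X \<in> grW_filtration n F p \<inter> grW_filtration n Fbar q"
  then obtain x y where x: "x \<in> F p" "x \<in> WC n" "X = pr n x" and y: "y \<in> Fbar q" "y \<in> WC n" "X = pr n y"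
    unfolding grW_filtration_eq by blast
  note car = WC_carrier[OF x(2)] WC_carrier[OF y(2)]
  note zero = HC.subspaceD(2)[OF Fbar_subspace[of q]] HC.subspaceD(2)[OF F_subspace[of p]]
  from assms have "y \<in> F p \<or> x \<in> Fbar q"
  proof (elim disjE)
    assume "F p = {\<zero>\<^bsub>HC\<^esub>}"
    then show ?thesis using x(1) zero by simp
  next
    assume "Fbar q = {\<zero>\<^bsub>HC\<^esub>}"
    then show ?thesis using y(1) zero by simp
  qed (use car in simp_all)
  then have "x \<in> F p \<inter> Fbar q \<inter> WC n \<or> y \<in> F p \<inter> Fbar q \<inter> WC n"
    using x y by blast
  then show "X \<in> lifted n p q" unfolding lifted_def using x y by blast
qed

text \<open>The projection has kernel \<open>F p \<inter> Fbar q \<inter> WC (n - 1)\<close> on this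
  space. The difference form makes the sum over \<open>n\<close> telescope.\<close>

lemma sdim_lifted:
  "real (vectorspace.sdim complex_field (grW n) (lifted n p q)) =
    real (HC.sdim (F p \<inter> Fbar q \<inter> WC n)) - real (HC.sdim (F p \<inter> Fbar q \<inter> WC (n - 1)))"
proof -
  have "F p \<inter> Fbar q \<inter> WC n \<inter> WC (n - 1) = F p \<inter> Fbar q \<inter> WC (n - 1)"
    using WC_mono[of "n - 1" n] by auto
  then show ?thesis
    using sdim_pr_image[OF FFbarW_subspace, of p q n n] by (simp add: lifted_def)
qed

end

section \<open>Deligne's bigrading\<close>

context mixed_hodge_structure
begin

lemma opposed:
  "opposed_filtrations complex_field (grW n) (grW_filtration n F) (grW_filtration n Fbar) n"
proof (intro opposed_filtrations.intro opposed_filtrations_axioms.intro grW_vectorspace grW_fin_dim)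
  have dec: "decreasing_filtration complex_field (grW n) (grW_filtration n E)"
    if "decreasing_filtration complex_field HC E" for E
    unfolding grW_filtration_def by (rule grW_filtration_decreasing[OF that])
  show "decreasing_filtration complex_field (grW n) (grW_filtration n F)"
    by (rule dec[OF F_filtration])
  show "decreasing_filtration complex_field (grW n) (grW_filtration n Fbar)"
    by (rule dec[OF Fbar_filtration])
  note pure = grW_pure[of n, unfolded pure_hodge_structure_def conj_grW_filtration]
  show "grW_filtration n F p <+>\<^bsub>grW n\<^esub> grW_filtration n Fbar (n + 1 - p) = carrier (grW n)"
    "grW_filtration n F p \<inter> grW_filtration n Fbar (n + 1 - p) = {\<zero>\<^bsub>grW n\<^esub>}" for p
    using pure by blast+
qed

text \<open>The spanning half of purity in terms of vectors; \<open>c\<close> accounts for the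
  choice of representatives of cosets.\<close>

lemma pure_decompose:
  assumes w: "w \<in> WC n"
  obtains a b c where "a \<in> F p" "a \<in> WC n" "b \<in> Fbar (n + 1 - p)" "b \<in> WC n" "c \<in> WC (n - 1)"
    "w = (a \<oplus>\<^bsub>HC\<^esub> b) \<oplus>\<^bsub>HC\<^esub> c"
proof -
  interpret opposed_filtrations complex_field "grW n" "grW_filtration n F" "grW_filtration n Fbar" n
    by (rule opposed)
  have "pr n w \<in> grW_filtration n F p <+>\<^bsub>grW n\<^esub> grW_filtration n Fbar (n + 1 - p)"
    unfolding sum_eq grW_carrier using w by blast
  then obtain a b where a: "a \<in> F p" "a \<in> WC n" and b: "b \<in> Fbar (n + 1 - p)" "b \<in> WC n"
    and eq: "pr n w = pr n a \<oplus>\<^bsub>grW n\<^esub> pr n b"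
    unfolding set_add_def' grW_filtration_eq by blast
  have ab: "a \<oplus>\<^bsub>HC\<^esub> b \<in> WC n" using HC.subspaceD(3)[OF WC_subspace a(2) b(2)] .
  have c: "w \<ominus>\<^bsub>HC\<^esub> (a \<oplus>\<^bsub>HC\<^esub> b) \<in> WC (n - 1)"
    using eq unfolding pr_add[OF a(2) b(2)] pr_eq_iff[OF w ab] .
  have "w = (w \<ominus>\<^bsub>HC\<^esub> (a \<oplus>\<^bsub>HC\<^esub> b)) \<oplus>\<^bsub>HC\<^esub> (a \<oplus>\<^bsub>HC\<^esub> b)"
    using HC.diff_add_cancel[OF WC_carrier[OF w] WC_carrier[OF ab]] by simp
  then have "w = (a \<oplus>\<^bsub>HC\<^esub> b) \<oplus>\<^bsub>HC\<^esub> (w \<ominus>\<^bsub>HC\<^esub> (a \<oplus>\<^bsub>HC\<^esub> b))"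
    using HC.M.a_comm[OF WC_carrier[OF c] WC_carrier[OF ab]] by simp
  then show ?thesis using that a b c by blast
qed

text \<open>The other half of purity in terms of vectors: a class in both induced filtrations is
  zero when the indices add up to \<open>n + 1\<close>.\<close>

lemma pure_disjoint:
  assumes x: "x \<in> F p" "x \<in> WC n" and y: "y \<in> Fbar q" "y \<in> WC n" and pq: "p + q = n + 1"
    and xy: "x \<ominus>\<^bsub>HC\<^esub> y \<in> WC (n - 1)"
  shows "x \<in> WC (n - 1)"
proof -
  interpret opposed_filtrations complex_field "grW n" "grW_filtration n F" "grW_filtration n Fbar" n
    by (rule opposed)
  have "pr n x = pr n y" using xy unfolding pr_eq_iff[OF x(2) y(2)] .
  then have "pr n x \<in> grW_filtration n F p \<inter> grW_filtration n Fbar q"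
    unfolding grW_filtration_eq using x y by blast
  then have "pr n x = WC (n - 1)" using Int_eq_zero[of p q] pq grW_zero by simp
  then show ?thesis using HC.coset_eq_self_iff[OF WC_subspace WC_carrier[OF x(2)]] by simp
qed

section \<open>The two factors in the formula for \<open>deligne_I\<close>\<close>

definition deligne_tail :: "int \<Rightarrow> int \<Rightarrow> 'c set" where
  "deligne_tail p q = HC.span (\<Union>i\<in>{1..}. Fbar (q - i) \<inter> WC (p + q - i - 1))"

definition deligne_right :: "int \<Rightarrow> int \<Rightarrow> 'c set" where
  "deligne_right p q = (Fbar q \<inter> WC (p + q)) <+>\<^bsub>HC\<^esub> deligne_tail p q"

lemma deligne_I_eq: "deligne_I p q = F p \<inter> WC (p + q) \<inter> deligne_right p q"
  by (simp add: deligne_I_def deligne_right_def deligne_tail_def)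

lemma deligne_generators_carrier: "(\<Union>i\<in>{1..}. Fbar (q - i) \<inter> WC (p + q - i - 1)) \<subseteq> carrier HC"
  using WC_carrier by blast

lemma deligne_tail_subspace: "subspace complex_field (deligne_tail p q) HC"
  unfolding deligne_tail_def by (rule HC.span_is_subspace[OF deligne_generators_carrier])

lemma deligne_right_subspace: "subspace complex_field (deligne_right p q) HC"
  unfolding deligne_right_def
  by (intro HC.subspace_set_add HC.subspace_Int Fbar_subspace WC_subspace deligne_tail_subspace)

lemma deligne_I_subspace: "subspace complex_field (deligne_I p q) HC"
  unfolding deligne_I_eq by (intro HC.subspace_Int F_subspace WC_subspace deligne_right_subspace)

lemma in_deligne_right:
  assumes "x \<in> Fbar q" "x \<in> WC (p + q)"
  shows "x \<in> deligne_right p q"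
proof -
  have "x = x \<oplus>\<^bsub>HC\<^esub> \<zero>\<^bsub>HC\<^esub>" using WC_carrier[OF assms(2)] by simp
  then show ?thesis
    unfolding deligne_right_def set_add_def'
    using assms HC.subspaceD(2)[OF deligne_tail_subspace] by blast
qed

lemma tail_in_deligne_right:
  assumes "i \<ge> 1" "x \<in> Fbar (q - i)" "x \<in> WC (p + q - i - 1)"
  shows "x \<in> deligne_right p q"
proof -
  have x: "x \<in> deligne_tail p q"
    unfolding deligne_tail_def using assms HC.in_own_span[OF deligne_generators_carrier] by blast
  have "x = \<zero>\<^bsub>HC\<^esub> \<oplus>\<^bsub>HC\<^esub> x" using WC_carrier[OF assms(3)] by simp
  then show ?thesis
    unfolding deligne_right_def set_add_def'
    using x HC.subspaceD(2)[OF HC.subspace_Int[OF Fbar_subspace WC_subspace]] by blast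
qed

lemma set_add_subspace_mem:
  assumes "subspace complex_field S HC" "subspace complex_field T HC"
  shows "S \<subseteq> S <+>\<^bsub>HC\<^esub> T" "T \<subseteq> S <+>\<^bsub>HC\<^esub> T"
  using HC.subspaceD(2,7)[OF assms(1)] HC.subspaceD(2,7)[OF assms(2)]
  unfolding set_add_def' by force+

text \<open>So the tail is invisible in the graded piece of weight \<open>p + q\<close>: there, an
  element of \<open>deligne_right p q\<close> has the class of its component in
  \<open>Fbar q\<close>.\<close>

lemma deligne_tail_subset: "deligne_tail p q \<subseteq> WC (p + q - 1)"
proof -
  have "Fbar (q - i) \<inter> WC (p + q - i - 1) \<subseteq> WC (p + q - 1)" if "i \<ge> 1" for i
    using WC_mono[of "p + q - i - 1" "p + q - 1"] that by auto
  then show ?thesis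
    unfolding deligne_tail_def by (intro HC.span_is_subset HC.is_module WC_subspace) auto
qed

text \<open>Modulo \<open>W\<^sub>n\<^sub>-\<^sub>k\<^sub>-\<^sub>1\<close>, where \<open>n = p + q\<close>, only the summands with \<open>i < k\<close> survive.\<close>

lemma deligne_right_subset:
  assumes k: "k \<ge> 1"
  shows "deligne_right p q \<subseteq> Fbar (q - k + 1) <+>\<^bsub>HC\<^esub> WC (p + q - k - 1)" (is "_ \<subseteq> ?T")
proof -
  have T: "subspace complex_field ?T HC" by (intro HC.subspace_set_add Fbar_subspace WC_subspace)
  note mem = set_add_subspace_mem[OF Fbar_subspace[of "q - k + 1"] WC_subspace[of "p + q - k - 1"]]
  have "Fbar (q - i) \<inter> WC (p + q - i - 1) \<subseteq> ?T" if "i \<ge> 1" for i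
  proof (cases "i < k")
    case True
    then show ?thesis using mem(1) Fbar_anti[of "q - k + 1" "q - i"] by auto
  next
    case False
    then show ?thesis using mem(2) WC_mono[of "p + q - i - 1" "p + q - k - 1"] by auto
  qed
  then have tail: "deligne_tail p q \<subseteq> ?T"
    unfolding deligne_tail_def by (intro HC.span_is_subset HC.is_module T) auto
  have "Fbar q \<subseteq> ?T" using mem(1) Fbar_anti[of "q - k + 1" q] k by auto
  then show ?thesis
    unfolding deligne_right_def set_add_def'[of HC "Fbar q \<inter> WC (p + q)"]
    using tail HC.subspaceD(3)[OF T] by blast
qed

text \<open>This is injectivity of the projection of \<open>deligne_I p q\<close> to the graded
  piece of weight \<open>p + q\<close>. A vector that has reached \<open>WC (p + q - k)\<close> is,
  modulo the next lower weight, in \<open>F p\<close> and in \<open>Fbar (q - k + 1)\<close>. These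
  indices add up to one more than \<open>p + q - k\<close>, so purity pushes the vector one weight
  further down, until it is zero.\<close>

lemma deligne_I_eq_zero:
  assumes x: "x \<in> deligne_I p q" "x \<in> WC (p + q - 1)"
  shows "x = \<zero>\<^bsub>HC\<^esub>"
proof -
  have xF: "x \<in> F p" and xS: "x \<in> deligne_right p q" using x(1) by (auto simp: deligne_I_eq)
  have step: "x \<in> WC (p + q - k - 1)" if k: "k \<ge> 1" and xk: "x \<in> WC (p + q - k)" for k
  proof -
    obtain z w where z: "z \<in> Fbar (q - k + 1)" and w: "w \<in> WC (p + q - k - 1)" and eq: "x = z \<oplus>\<^bsub>HC\<^esub> w"
      using deligne_right_subset[OF k, of p q] xS unfolding set_add_def' by blast
    have car: "z \<in> carrier HC" "w \<in> carrier HC"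
      using z w HC.subspaceD(7)[OF Fbar_subspace] WC_carrier by blast+
    have "w \<in> WC (p + q - k)" using w WC_mono[of "p + q - k - 1" "p + q - k"] by auto
    then have "z \<in> WC (p + q - k)"
      using HC.subspaceD(6)[OF WC_subspace xk] HC.add_diff_cancel_right[OF car] eq by metis
    then show ?thesis
      using pure_disjoint[OF xF xk z] HC.add_diff_cancel_left[OF car] eq w by simp
  qed
  have all: "x \<in> WC (p + q - k)" if "k \<ge> 1" for k
    using that
  proof (induction k rule: int_ge_induct)
    case (step k)
    then show ?case using step(2) assms \<open>\<And>k. 1 \<le> k \<Longrightarrow> x \<in> WC (p + q - k) \<Longrightarrow> x \<in> WC (p + q - k - 1)\<close>[of k]
      by (simp add: algebra_simps)
  qed (use x in simp)
  obtain N where "\<forall>n\<le>N. WC n = {\<zero>\<^bsub>HC\<^esub>}" using WC_bounded by blast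
  \<comment> \<open>This depth is at least 1 and leads to a weight of at most \<open>N\<close>,
    where the filtration is zero.\<close>
  then show ?thesis using all[of "max 1 (p + q - N)"] by simp
qed

text \<open>This is surjectivity onto the classes of type \<open>(p, q)\<close>, by successive
  correction. Vectors \<open>u\<close> in \<open>F p\<close> and \<open>v\<close> in
  \<open>deligne_right p q\<close> that agree modulo \<open>WC (p + q - k)\<close> are improved by
  purity of that weight: the \<open>F\<close> part of their difference is subtracted from
  \<open>u\<close>, and the \<open>Fbar\<close> part is added to \<open>v\<close>. The index shifts
  in the tail are exactly those that admit the second correction, with
  \<open>i = k - 1\<close>.\<close>

lemma deligne_I_lift:
  assumes x: "x \<in> F p" "x \<in> WC (p + q)" and y: "y \<in> Fbar q" "y \<in> WC (p + q)"
    and xy: "x \<ominus>\<^bsub>HC\<^esub> y \<in> WC (p + q - 1)"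
  shows "\<exists>z\<in>deligne_I p q. z \<ominus>\<^bsub>HC\<^esub> x \<in> WC (p + q - 1)"
proof -
  let ?P = "\<lambda>k u v. u \<in> F p \<and> u \<in> WC (p + q) \<and> v \<in> deligne_right p q \<and>
    u \<ominus>\<^bsub>HC\<^esub> v \<in> WC (p + q - k) \<and> u \<ominus>\<^bsub>HC\<^esub> x \<in> WC (p + q - 1)"
  note car = WC_carrier HC.subspaceD(7)[OF deligne_right_subspace]
  have *: "\<exists>u v. ?P k u v" if "k \<ge> 1" for k
    using that
  proof (induction k rule: int_ge_induct)
    case base
    have "x \<ominus>\<^bsub>HC\<^esub> x = \<zero>\<^bsub>HC\<^esub>" using WC_carrier[OF x(2)] by simp
    then have "?P 1 x y" using x xy in_deligne_right[OF y] HC.subspaceD(2)[OF WC_subspace] by simp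
    then show ?case by blast
  next
    case (step k)
    then obtain u v where u: "u \<in> F p" "u \<in> WC (p + q)" and v: "v \<in> deligne_right p q"
      and uv: "u \<ominus>\<^bsub>HC\<^esub> v \<in> WC (p + q - k)" and ux: "u \<ominus>\<^bsub>HC\<^esub> x \<in> WC (p + q - 1)" by blast
    from uv obtain a b c where a: "a \<in> F p" "a \<in> WC (p + q - k)"
      and b: "b \<in> Fbar (p + q - k + 1 - p)" "b \<in> WC (p + q - k)" and c: "c \<in> WC (p + q - k - 1)"
      and eq: "u \<ominus>\<^bsub>HC\<^esub> v = (a \<oplus>\<^bsub>HC\<^esub> b) \<oplus>\<^bsub>HC\<^esub> c"
      by (rule pure_decompose)
    have b': "b \<in> Fbar (q - (k - 1))" "b \<in> WC (p + q - (k - 1) - 1)"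
      using b by (simp_all add: algebra_simps)
    have bS: "b \<in> deligne_right p q"
    \<comment> \<open>The tail starts at \<open>i = 1\<close>, so the first correction goes into the
      summand \<open>Fbar q \<inter> WC (p + q)\<close> instead.\<close>
    proof (cases "k = 1")
      case True
      then show ?thesis using b' WC_mono[of "p + q - 1" "p + q"] by (intro in_deligne_right) auto
    next
      case False
      then show ?thesis using tail_in_deligne_right[OF _ b'] step(1) by simp
    qed
    have aW: "a \<in> WC (p + q - 1)" "a \<in> WC (p + q)"
      using a(2) step(1) WC_mono[of "p + q - k" "p + q - 1"] WC_mono[of "p + q - k" "p + q"] by auto
    have "(u \<ominus>\<^bsub>HC\<^esub> a) \<ominus>\<^bsub>HC\<^esub> (v \<oplus>\<^bsub>HC\<^esub> b) = c"
      using HC.diff_diff_add[OF car(1)[OF u(2)] car(2)[OF v] car(1)[OF a(2)] car(1)[OF b(2)] car(1)[OF c] eq] .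
    moreover have "(u \<ominus>\<^bsub>HC\<^esub> a) \<ominus>\<^bsub>HC\<^esub> x = (u \<ominus>\<^bsub>HC\<^esub> x) \<ominus>\<^bsub>HC\<^esub> a"
      using HC.diff_diff_swap[OF car(1)[OF u(2)] car(1)[OF a(2)] car(1)[OF x(2)]] .
    moreover have "c \<in> WC (p + q - (k + 1))" using c by (simp only: diff_diff_eq)
    ultimately have "?P (k + 1) (u \<ominus>\<^bsub>HC\<^esub> a) (v \<oplus>\<^bsub>HC\<^esub> b)"
      using HC.subspaceD(6)[OF F_subspace u(1) a(1)] HC.subspaceD(6)[OF WC_subspace u(2) aW(2)]
        HC.subspaceD(3)[OF deligne_right_subspace v bS] HC.subspaceD(6)[OF WC_subspace ux aW(1)]
      by simp
    then show ?case by blast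
  qed
  obtain N where "\<forall>n\<le>N. WC n = {\<zero>\<^bsub>HC\<^esub>}" using WC_bounded by blast
  then have N: "WC (p + q - max 1 (p + q - N)) = {\<zero>\<^bsub>HC\<^esub>}" by simp
  obtain u v where uv: "?P (max 1 (p + q - N)) u v" using *[of "max 1 (p + q - N)"] by auto
  then have "u \<ominus>\<^bsub>HC\<^esub> v = \<zero>\<^bsub>HC\<^esub>" using N by simp
  \<comment> \<open>At this depth the error space is zero, and the common vector lies in both
    factors of \<open>deligne_I p q\<close>.\<close>
  then have "u = v" using HC.minus_other_side[of u v] uv car by blast
  then have "u \<in> deligne_I p q" using uv by (simp add: deligne_I_eq)
  then show ?thesis using uv by blast
qed

text \<open>The condition on lifts for the diagonal \<open>n = p + q\<close> only: \<open>x\<close>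
  and \<open>y\<close> represent one class, which is then of type \<open>(p, q)\<close>.\<close>

definition hodge_classes_lift :: bool where
  "hodge_classes_lift \<longleftrightarrow> (\<forall>p q. \<forall>x\<in>F p \<inter> WC (p + q). \<forall>y\<in>Fbar q \<inter> WC (p + q).
     x \<ominus>\<^bsub>HC\<^esub> y \<in> WC (p + q - 1) \<longrightarrow> (\<exists>z\<in>F p \<inter> Fbar q \<inter> WC (p + q). z \<ominus>\<^bsub>HC\<^esub> x \<in> WC (p + q - 1)))"

text \<open>Surjectivity of the projection from \<open>deligne_I p q\<close>
  (\<open>deligne_I_lift\<close>) gives one direction, and its injectivity
  (\<open>deligne_I_eq_zero\<close>) gives the other.\<close>

lemma R_split_iff: "R_split \<longleftrightarrow> hodge_classes_lift"
proof
  assume split: R_split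
  show hodge_classes_lift
    unfolding hodge_classes_lift_def
  proof (intro allI ballI impI)
    fix p q x y
    assume x: "x \<in> F p \<inter> WC (p + q)" and y: "y \<in> Fbar q \<inter> WC (p + q)"
      and "x \<ominus>\<^bsub>HC\<^esub> y \<in> WC (p + q - 1)"
    then obtain z where z: "z \<in> deligne_I p q" "z \<ominus>\<^bsub>HC\<^esub> x \<in> WC (p + q - 1)"
      using deligne_I_lift[of x p q y] by blast
    have "z \<in> conjugation ` deligne_I q p" using split z(1) unfolding R_split_def by blast
    then have "z \<in> Fbar q" unfolding deligne_I_eq Fbar_def by blast
    then show "\<exists>z\<in>F p \<inter> Fbar q \<inter> WC (p + q). z \<ominus>\<^bsub>HC\<^esub> x \<in> WC (p + q - 1)"
      using z unfolding deligne_I_eq by blast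
  qed
next
  assume lift: hodge_classes_lift
  have I_eq: "deligne_I p q = F p \<inter> Fbar q \<inter> WC (p + q)" for p q
  proof
    show sub: "F p \<inter> Fbar q \<inter> WC (p + q) \<subseteq> deligne_I p q"
      unfolding deligne_I_eq using in_deligne_right by blast
    show "deligne_I p q \<subseteq> F p \<inter> Fbar q \<inter> WC (p + q)"
    proof
      fix x assume x: "x \<in> deligne_I p q"
      then have xFW: "x \<in> F p \<inter> WC (p + q)" by (simp add: deligne_I_eq)
      from x obtain y s where y: "y \<in> Fbar q \<inter> WC (p + q)" and s: "s \<in> deligne_tail p q"
        and eq: "x = y \<oplus>\<^bsub>HC\<^esub> s"
        unfolding deligne_I_eq deligne_right_def set_add_def' by blast
      have sW: "s \<in> WC (p + q - 1)" using s deligne_tail_subset by blast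
      have "x \<ominus>\<^bsub>HC\<^esub> y = s"
        unfolding eq using y sW WC_carrier by (intro HC.add_diff_cancel_left) blast+
      then obtain z where z: "z \<in> F p \<inter> Fbar q \<inter> WC (p + q)" "z \<ominus>\<^bsub>HC\<^esub> x \<in> WC (p + q - 1)"
        using lift xFW y sW unfolding hodge_classes_lift_def by blast
      \<comment> \<open>The lift \<open>z\<close> also belongs to \<open>deligne_I p q\<close> and
        has the same class as \<open>x\<close>, so injectivity forces \<open>z = x\<close>.\<close>
      have "z \<ominus>\<^bsub>HC\<^esub> x \<in> deligne_I p q"
        using HC.subspaceD(6)[OF deligne_I_subspace _ x] z(1) sub by blast
      then have "z \<ominus>\<^bsub>HC\<^esub> x = \<zero>\<^bsub>HC\<^esub>" using z(2) by (rule deligne_I_eq_zero)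
      then have "z = x" using HC.minus_other_side[of z x] z(1) xFW WC_carrier by blast
      then show "x \<in> F p \<inter> Fbar q \<inter> WC (p + q)" using z(1) by simp
    qed
  qed
  show R_split
    unfolding R_split_def
  proof (intro allI)
    fix p q :: int
    have comm: "q + p = p + q" by simp
    have "conjugation ` (F q \<inter> Fbar p \<inter> WC (p + q)) = F p \<inter> Fbar q \<inter> WC (p + q)"
    proof
      show "conjugation ` (F q \<inter> Fbar p \<inter> WC (p + q)) \<subseteq> F p \<inter> Fbar q \<inter> WC (p + q)"
        using conj_F conj_Fbar conj_WC_mem by blast
      show "F p \<inter> Fbar q \<inter> WC (p + q) \<subseteq> conjugation ` (F q \<inter> Fbar p \<inter> WC (p + q))"
      proof
        fix x assume x: "x \<in> F p \<inter> Fbar q \<inter> WC (p + q)"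
        then have "conjugation x \<in> F q \<inter> Fbar p \<inter> WC (p + q)"
          using conj_F conj_Fbar conj_WC_mem by blast
        moreover have "conjugation (conjugation x) = x" using x WC_carrier conj_conj by blast
        ultimately show "x \<in> conjugation ` (F q \<inter> Fbar p \<inter> WC (p + q))" by (metis image_eqI)
      qed
    qed
    then show "deligne_I p q = conjugation ` deligne_I q p"
      unfolding I_eq comm by simp
  qed
qed

text \<open>The left side covers only \<open>p + q = n\<close>;
  \<open>Int_subset_if_diagonal\<close>, applied to \<open>lifted n\<close>, extends it to all
  \<open>p\<close> and \<open>q\<close>.\<close>

lemma hodge_classes_lift_iff: "hodge_classes_lift \<longleftrightarrow> (\<forall>n p q. defect n p q = 0)"
proof
  assume lift: hodge_classes_lift
  show "\<forall>n p q. defect n p q = 0"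
    unfolding defect_eq_0_iff
  proof (intro allI)
    fix n p q
    interpret opposed_filtrations complex_field "grW n" "grW_filtration n F" "grW_filtration n Fbar" n
      by (rule opposed)
    show "grW_filtration n F p \<inter> grW_filtration n Fbar q \<subseteq> lifted n p q"
    proof (rule Int_subset_if_diagonal[OF lifted_subspace lifted_anti])
      fix p q assume n: "p + q = n"
      show "grW_filtration n F p \<inter> grW_filtration n Fbar q \<subseteq> lifted n p q"
      proof
        fix X assume "X \<in> grW_filtration n F p \<inter> grW_filtration n Fbar q"
        then obtain x y where x: "x \<in> F p" "x \<in> WC n" "X = pr n x" and y: "y \<in> Fbar q" "y \<in> WC n" "X = pr n y"
          unfolding grW_filtration_eq by blast
        then have "x \<ominus>\<^bsub>HC\<^esub> y \<in> WC (n - 1)" using pr_eq_iff[OF x(2) y(2)] by simp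
        then obtain z where z: "z \<in> F p \<inter> Fbar q \<inter> WC n" "z \<ominus>\<^bsub>HC\<^esub> x \<in> WC (n - 1)"
          using lift x y n unfolding hodge_classes_lift_def by blast
        then have "pr n z = pr n x" using pr_eq_iff[of z n x] x by blast
        then show "X \<in> lifted n p q" unfolding lifted_def using z x by blast
      qed
    qed
  qed
next
  assume defect: "\<forall>n p q. defect n p q = 0"
  show hodge_classes_lift
    unfolding hodge_classes_lift_def
  proof (intro allI ballI impI)
    fix p q x y
    assume x: "x \<in> F p \<inter> WC (p + q)" and y: "y \<in> Fbar q \<inter> WC (p + q)"
      and xy: "x \<ominus>\<^bsub>HC\<^esub> y \<in> WC (p + q - 1)"
    let ?n = "p + q"
    have "pr ?n x = pr ?n y" using pr_eq_iff[of x ?n y] x y xy by blast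
    then have "pr ?n x \<in> grW_filtration ?n F p \<inter> grW_filtration ?n Fbar q"
      unfolding grW_filtration_eq using x y by blast
    then have "pr ?n x \<in> lifted ?n p q" using defect unfolding defect_eq_0_iff by blast
    then obtain z where z: "z \<in> F p \<inter> Fbar q \<inter> WC ?n" "pr ?n x = pr ?n z"
      unfolding lifted_def by blast
    then have "z \<ominus>\<^bsub>HC\<^esub> x \<in> WC (?n - 1)" using pr_eq_iff[of z ?n x] x by auto
    then show "\<exists>z\<in>F p \<inter> Fbar q \<inter> WC ?n. z \<ominus>\<^bsub>HC\<^esub> x \<in> WC (?n - 1)" using z(1) by blast
  qed
qed

end

section \<open>The invariant \<open>alpha\<close>\<close>

context mixed_hodge_structure
begin

definition tdim :: "int \<Rightarrow> int \<Rightarrow> real" where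
  "tdim p q = real (HC.sdim (F p \<inter> Fbar q))"

lemma hodge_t_eq:
  "real (hodge_t p q) = tdim p q - tdim (p + 1) q - tdim p (q + 1) + tdim (p + 1) (q + 1)"
  unfolding hodge_t_def tdim_def
  by (rule gr_gr_dim_eq[OF HC.vectorspace_axioms HC_fin_dim F_filtration Fbar_filtration])

text \<open>The weight \<open>n\<close> is a variable of its own because it stays fixed while
  \<open>p\<close> and \<open>q\<close> are shifted.\<close>

lemma hodge_h_eq:
  assumes n: "n = p + q"
  shows "real (hodge_h p q) = grdim n p q - grdim n (p + 1) q - grdim n p (q + 1) + grdim n (p + 1) (q + 1)"
proof -
  interpret opposed_filtrations complex_field "grW n" "grW_filtration n F" "grW_filtration n Fbar" n
    by (rule opposed)
  show ?thesis
    unfolding hodge_h_def grdim_def n[symmetric]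
    by (rule gr_gr_dim_eq[OF grW_vectorspace grW_fin_dim F G])
qed

text \<open>Allows \<open>hodge_h p q\<close>, which refers to the weight \<open>p + q\<close>
  alone, to be written as a second difference of a sum over all weights.\<close>

lemma grdim_second_difference:
  assumes "p + q \<noteq> n"
  shows "grdim n p q - grdim n (p + 1) q - grdim n p (q + 1) + grdim n (p + 1) (q + 1) = 0"
proof -
  interpret opposed_filtrations complex_field "grW n" "grW_filtration n F" "grW_filtration n Fbar" n
    by (rule opposed)
  show ?thesis using sdim_second_difference[OF assms] by (simp add: grdim_def)
qed

text \<open>Nonzero numbers require a jump of both filtrations, so both families have finite
  support.\<close>

lemma hodge_numbers_constant:
  assumes "F p = F (p + 1) \<or> Fbar q = Fbar (q + 1)"
  shows "hodge_t p q = 0" "hodge_h p q = 0"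
proof -
  show "hodge_t p q = 0" using hodge_t_eq[of p q] assms by (auto simp: tdim_def)
  have "grW_filtration (p + q) F p = grW_filtration (p + q) F (p + 1) \<or>
      grW_filtration (p + q) Fbar q = grW_filtration (p + q) Fbar (q + 1)"
    using assms by (auto simp: grW_filtration_eq)
  then show "hodge_h p q = 0" using hodge_h_eq[OF refl, of p q] by (auto simp: grdim_def)
qed

text \<open>Summation by parts turns the weight \<open>(p + q)\<^sup>2\<close> into the constant 2.\<close>

lemma alpha_eq_sum_defect:
  obtains M0 where "\<And>M. M \<ge> M0 \<Longrightarrow>
    alpha = (\<Sum>p\<in>{-M..M}. \<Sum>q\<in>{-M..M}. \<Sum>n\<in>{-2*M..2*M}. defect n p q)"
proof -
  obtain M0 where M0: "M0 \<ge> 0" "\<And>p. p \<le> - M0 \<Longrightarrow> F p = carrier HC" "\<And>p. p \<ge> M0 \<Longrightarrow> F p = {\<zero>\<^bsub>HC\<^esub>}"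
    "\<And>n. n \<le> - M0 \<Longrightarrow> WC n = {\<zero>\<^bsub>HC\<^esub>}" "\<And>n. n \<ge> M0 \<Longrightarrow> WC n = carrier HC"
    by (rule bounded) blast
  show ?thesis
  proof (rule that[of M0])
    fix M assume M: "M \<ge> M0"
    define f where "f p q = (\<Sum>n\<in>{-2*M..2*M}. defect n p q)" for p q
    define g where "g p q = (\<Sum>n\<in>{-2*M..2*M}. grdim n p q)" for p q
    have F_low: "F p = carrier HC" "Fbar p = carrier HC" if "p \<le> - M" for p
      using M0(2)[of p] Fbar_eq(1)[of p] that M by auto
    have F_high: "F p = {\<zero>\<^bsub>HC\<^esub>}" "Fbar p = {\<zero>\<^bsub>HC\<^esub>}" if "p \<ge> M" for p
      using M0(3)[of p] Fbar_eq(2)[of p] that M by auto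
    have fg: "f p q = g p q - tdim p q" for p q
    proof -
      \<comment> \<open>Over all weights, the dimensions of the lifted classes add up to that of
        \<open>F p \<inter> Fbar q\<close>. The double negation puts \<open>sdim_lifted\<close> into
        the shape of \<open>sum_int_telescope\<close>.\<close>
      have "(\<Sum>n\<in>{-2*M..2*M}. real (vectorspace.sdim complex_field (grW n) (lifted n p q))) =
        (\<Sum>n\<in>{-2*M..2*M}. - real (HC.sdim (F p \<inter> Fbar q \<inter> WC (n - 1)))
          - - real (HC.sdim (F p \<inter> Fbar q \<inter> WC (n + 1 - 1))))"
        unfolding sdim_lifted by simp
      also have "\<dots> = - real (HC.sdim (F p \<inter> Fbar q \<inter> WC (-2*M - 1)))
          - - real (HC.sdim (F p \<inter> Fbar q \<inter> WC (2*M + 1 - 1)))"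
        using M M0(1) by (intro sum_int_telescope) simp
      also have "F p \<inter> Fbar q \<inter> WC (-2*M - 1) = {\<zero>\<^bsub>HC\<^esub>}"
        using M0(4)[of "-2*M - 1"] M M0(1) HC.subspaceD(2)[OF F_subspace[of p]]
          HC.subspaceD(2)[OF Fbar_subspace[of q]] by auto
      also have "F p \<inter> Fbar q \<inter> WC (2*M + 1 - 1) = F p \<inter> Fbar q"
        using M0(5)[of "2*M"] M M0(1) HC.subspaceD(1)[OF F_subspace[of p]] by auto
      finally show ?thesis
        by (simp add: f_def g_def defect_def sum_subtractf tdim_def HC.sdim_zero)
    qed
    have diff: "real (hodge_h p q) - real (hodge_t p q) =
        f p q - f (p + 1) q - f p (q + 1) + f (p + 1) (q + 1)"
      if pq: "p \<in> {-M..M}" "q \<in> {-M..M}" for p q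
    proof -
      \<comment> \<open>The weights range up to \<open>2 * M\<close> in absolute value so that
        \<open>p + q\<close> is always among them.\<close>
      have "real (hodge_h p q) = (\<Sum>n\<in>{-2*M..2*M}. if n = p + q then real (hodge_h p q) else 0)"
        using pq by simp
      also have "\<dots> = (\<Sum>n\<in>{-2*M..2*M}.
          grdim n p q - grdim n (p + 1) q - grdim n p (q + 1) + grdim n (p + 1) (q + 1))"
        using hodge_h_eq grdim_second_difference by (intro sum.cong refl) auto
      also have "\<dots> = g p q - g (p + 1) q - g p (q + 1) + g (p + 1) (q + 1)"
        by (simp add: g_def sum.distrib sum_subtractf)
      finally show ?thesis by (simp add: hodge_t_eq fg)
    qed
    have zero: "hodge_t p q = 0 \<and> hodge_h p q = 0" if "p \<notin> {-M..M} \<or> q \<notin> {-M..M}" for p q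
    proof -
      have const: "F r = F (r + 1)" "Fbar r = Fbar (r + 1)" if r: "r \<notin> {-M..M}" for r
      proof -
        \<comment> \<open>Even at \<open>r = - M - 1\<close> the successor still lies in the range
          where the filtrations are the whole space.\<close>
        consider "r + 1 \<le> - M" | "r \<ge> M" using r by fastforce
        then show "F r = F (r + 1)" "Fbar r = Fbar (r + 1)"
          using F_low[of r] F_low[of "r + 1"] F_high[of r] F_high[of "r + 1"] by (cases; simp)+
      qed
      show ?thesis using hodge_numbers_constant[of p q] const that by blast
    qed
    let ?c = "\<lambda>(p, q). (real_of_int (p + q))\<^sup>2 * (real (hodge_h p q) - real (hodge_t p q))"
    have "Sum_any ?c = sum ?c ({-M..M} \<times> {-M..M})"
    proof (rule Sum_any.expand_superset)
      show "{x. ?c x \<noteq> 0} \<subseteq> {-M..M} \<times> {-M..M}"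
      proof
        fix x assume x: "x \<in> {x. ?c x \<noteq> 0}"
        obtain p q where pq: "x = (p, q)" by (cases x)
        have "\<not> (hodge_t p q = 0 \<and> hodge_h p q = 0)" using x unfolding pq by auto
        then have "\<not> (p \<notin> {-M..M} \<or> q \<notin> {-M..M})" using zero by blast
        then show "x \<in> {-M..M} \<times> {-M..M}" unfolding pq by blast
      qed
    qed simp
    also have "\<dots> = (\<Sum>p\<in>{-M..M}. \<Sum>q\<in>{-M..M}.
        (real_of_int (p + q))\<^sup>2 * (real (hodge_h p q) - real (hodge_t p q)))"
      by (rule sum.cartesian_product[symmetric])
    also have "\<dots> = (\<Sum>p\<in>{-M..M}. \<Sum>q\<in>{-M..M}.
        (real_of_int (p + q))\<^sup>2 * (f p q - f (p + 1) q - f p (q + 1) + f (p + 1) (q + 1)))"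
      by (intro sum.cong refl) (simp only: diff)
    also have "\<dots> = 2 * (\<Sum>p\<in>{-M..M}. \<Sum>q\<in>{-M..M}. f p q)"
    proof (rule sum_square_second_difference)
      \<comment> \<open>At \<open>- M\<close> one of the filtrations is the whole space and at
        \<open>M + 1\<close> it is zero, so \<open>defect_extreme\<close> kills every
        summand.\<close>
      show "f (- M) q = 0" "f (M + 1) q = 0" "f p (- M) = 0" "f p (M + 1) = 0" for p q
        unfolding f_def using F_low[of "- M"] F_high[of "M + 1"] by (simp_all add: defect_extreme)
    qed (use M M0(1) in simp)
    finally show "alpha = (\<Sum>p\<in>{-M..M}. \<Sum>q\<in>{-M..M}. \<Sum>n\<in>{-2*M..2*M}. defect n p q)"
      by (simp add: alpha_def f_def)
  qed
qed

text \<open>A finite sum of nonnegative terms vanishes only if each term does.\<close>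

lemma alpha_eq_0_iff: "alpha = 0 \<longleftrightarrow> (\<forall>n p q. defect n p q = 0)"
proof
  assume zero: "alpha = 0"
  obtain M0 where M0: "\<And>M. M \<ge> M0 \<Longrightarrow>
      alpha = (\<Sum>p\<in>{-M..M}. \<Sum>q\<in>{-M..M}. \<Sum>n\<in>{-2*M..2*M}. defect n p q)"
    by (rule alpha_eq_sum_defect) blast
  show "\<forall>n p q. defect n p q = 0"
  proof (intro allI)
    fix n p q
    \<comment> \<open>The formula for \<open>alpha\<close> holds for all large \<open>M\<close>, so
      the range of summation can be made to contain the given indices.\<close>
    define M where "M = \<bar>M0\<bar> + \<bar>n\<bar> + \<bar>p\<bar> + \<bar>q\<bar>"
    have "M0 \<le> M" "\<bar>n\<bar> \<le> M" "\<bar>p\<bar> \<le> M" "\<bar>q\<bar> \<le> M"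
      unfolding M_def by linarith+
    then have M: "M0 \<le> M" "p \<in> {-M..M}" "q \<in> {-M..M}" "n \<in> {-2*M..2*M}"
      by (simp_all add: abs_le_iff)
    have "(\<Sum>p\<in>{-M..M}. \<Sum>q\<in>{-M..M}. \<Sum>n\<in>{-2*M..2*M}. defect n p q) = 0"
      using M0[OF M(1)] zero by (rule trans[OF sym])
    from sum_nonneg_0[OF _ _ this M(2)]
    have "(\<Sum>q\<in>{-M..M}. \<Sum>n\<in>{-2*M..2*M}. defect n p q) = 0"
      by (simp add: sum_nonneg defect_nonneg)
    from sum_nonneg_0[OF _ _ this M(3)]
    have "(\<Sum>n\<in>{-2*M..2*M}. defect n p q) = 0"
      by (simp add: sum_nonneg defect_nonneg)
    from sum_nonneg_0[OF _ _ this M(4)]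
    show "defect n p q = 0"
      by (simp add: defect_nonneg)
  qed
next
  assume defect: "\<forall>n p q. defect n p q = 0"
  obtain M0 where M0: "\<And>M. M \<ge> M0 \<Longrightarrow>
      alpha = (\<Sum>p\<in>{-M..M}. \<Sum>q\<in>{-M..M}. \<Sum>n\<in>{-2*M..2*M}. defect n p q)"
    by (rule alpha_eq_sum_defect) blast
  show "alpha = 0" using M0[OF order_refl] defect by simp
qed

end

theorem mainTheorem4:
  fixes HQ :: "(rat, 'q) module" and HC :: "(complex, 'c) module" and \<iota> :: "'q \<Rightarrow> 'c"
    and W :: "int \<Rightarrow> 'q set" and F :: "int \<Rightarrow> 'c set"
  assumes "mixed_hodge_structure HQ HC \<iota> W F"
  shows "mixed_hodge_structure.alpha HQ HC \<iota> W F = 0 \<longleftrightarrow> mixed_hodge_structure.R_split HQ HC \<iota> W F"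
proof -
  interpret mixed_hodge_structure HQ HC \<iota> W F by (rule assms)
  show ?thesis unfolding alpha_eq_0_iff R_split_iff hodge_classes_lift_iff ..
qed

end
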